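(* Let $\Gamma$ be a finitely generated infinite amenable group and let $\mu$ be an admissible probability measure on $\Gamma$, with return probability $p_\mu$ and spectral distribution $N_\mu$. Then, for $t\in\mathbb N$ near infinity, $$p_\mu(2t)\simeq\int_0^\infty\exp(-\lambda t)\,dN_\mu(\lambda).$$
   Context: Admissible measures: a probability measure $\mu$ on a finitely generated group $\Gamma$ is admissible if it is symmetric ($\mu(\{\gamma\})=\mu(\{\gamma^{-1}\})$ for all $\gamma$), has finite second moment ($\int_\Gamma l(\gamma)^2\,d\mu(\gamma)<\infty$, with $l$ the length function of some word metric on $\Gamma$), and its support contains a finite generating set of $\Gamma$. Return probability: $p_\mu(t)=\mu^{(t)}(\{e\})$, where $\mu^{(t)}$ is the $t$-th convolution power of $\mu$ and $e$ the unit element. Spectral distribution: let $R_\mu:l^2(\Gamma)\to l^2(\Gamma)$, $R_\mu(f)(x)=\sum_{\gamma\in\Gamma}f(x\gamma^{-1})\mu(\gamma)$, and $\Delta_\mu=\mathrm{id}-R_\mu$. Then $N_\mu(\lambda)=\langle\chi_{(-\infty,\lambda]}(\Delta_\mu)\delta_e,\delta_e\rangle_{l^2(\Gamma)}$ for $\lambda\ge0$. The integral is a Stieltjes integral over $[0,\infty)$ with respect to $N_\mu$ (a possible atom at $0$ is included). Asymptotic comparison: $f\preceq g$ near infinity means there are $C,D,x_0>0$ with $f(x)\le Cg(Dx)$ for all $x\ge x_0$; $f\simeq g$ means $f\preceq g$ and $g\preceq f$. For functions defined on $\mathbb N$ (here, both sides are regarded as functions of $t\in\mathbb N$), these relations are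 applied to their piecewise linear extensions. *)

theory Defs
  imports "HOL-Probability.Probability" "HOL-Algebra.Generated_Groups"
begin

section \<open>Finitely generated and amenable groups\<close>

definition finite_generating_set :: "('a, 'b) monoid_scheme \<Rightarrow> 'a set \<Rightarrow> bool" where
  "finite_generating_set G S \<longleftrightarrow>
     finite S \<and> S \<subseteq> carrier G \<and> generate G S = carrier G"

definition finitely_generated_group :: "('a, 'b) monoid_scheme \<Rightarrow> bool" where
  "finitely_generated_group G \<longleftrightarrow> group G \<and> (\<exists>S. finite_generating_set G S)"

definition word_length :: "('a, 'b) monoid_scheme \<Rightarrow> 'a set \<Rightarrow> 'a \<Rightarrow> nat" where
  "word_length G S g =
     (LEAST n. \<exists>xs. length xs = n \<and> set xs \<subseteq> S \<union> m_inv G ` S \<and>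
        foldr (mult G) xs \<one>\<^bsub>G\<^esub> = g)"

text \<open>
  A bounded function on the group is represented by any function on the type that is bounded on
  the carrier; additivity and positivity force a mean to ignore the values off the carrier.
\<close>

definition invariant_mean :: "('a, 'b) monoid_scheme \<Rightarrow> (('a \<Rightarrow> real) \<Rightarrow> real) \<Rightarrow> bool" where
  "invariant_mean G m \<longleftrightarrow>
     (let B = {f :: 'a \<Rightarrow> real. bounded (f ` carrier G)} in
       (\<forall>f\<in>B. \<forall>g\<in>B. m (\<lambda>x. f x + g x) = m f + m g) \<and>
       (\<forall>f\<in>B. \<forall>c. m (\<lambda>x. c * f x) = c * m f) \<and>
       (\<forall>f\<in>B. (\<forall>x\<in>carrier G. 0 \<le> f x) \<longrightarrow> 0 \<le> m f) \<and>
       m (\<lambda>x. 1) = 1 \<and>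
       (\<forall>f\<in>B. \<forall>g\<in>carrier G. m (\<lambda>x. f (g \<otimes>\<^bsub>G\<^esub> x)) = m f))"

definition amenable :: "('a, 'b) monoid_scheme \<Rightarrow> bool" where
  "amenable G \<longleftrightarrow> (\<exists>m. invariant_mean G m)"

section \<open>Admissible measures and return probabilities\<close>

text \<open>
  Finitely generated groups are countable, so their probability measures are exactly the
  probability mass functions supported in the carrier.
\<close>

definition finite_second_moment :: "('a, 'b) monoid_scheme \<Rightarrow> 'a pmf \<Rightarrow> bool" where
  "finite_second_moment G \<mu> \<longleftrightarrow>
     (\<exists>S. finite_generating_set G S \<and>
        integrable (measure_pmf \<mu>) (\<lambda>g. (real (word_length G S g))\<^sup>2))"

definition admissible :: "('a, 'b) monoid_scheme \<Rightarrow> 'a pmf \<Rightarrow> bool" where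
  "admissible G \<mu> \<longleftrightarrow>
     set_pmf \<mu> \<subseteq> carrier G \<and>
     (\<forall>g\<in>carrier G. pmf \<mu> g = pmf \<mu> (inv\<^bsub>G\<^esub> g)) \<and>
     finite_second_moment G \<mu> \<and>
     (\<exists>S. S \<subseteq> set_pmf \<mu> \<and> finite_generating_set G S)"

definition convolution_pmf ::
  "('a, 'b) monoid_scheme \<Rightarrow> 'a pmf \<Rightarrow> 'a pmf \<Rightarrow> 'a pmf" where
  "convolution_pmf G \<mu> \<nu> = map_pmf (\<lambda>(x, y). x \<otimes>\<^bsub>G\<^esub> y) (pair_pmf \<mu> \<nu>)"

primrec convolution_power :: "('a, 'b) monoid_scheme \<Rightarrow> 'a pmf \<Rightarrow> nat \<Rightarrow> 'a pmf" where
  "convolution_power G \<mu> 0 = return_pmf \<one>\<^bsub>G\<^esub>"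
| "convolution_power G \<mu> (Suc t) = convolution_pmf G (convolution_power G \<mu> t) \<mu>"

definition return_probability :: "('a, 'b) monoid_scheme \<Rightarrow> 'a pmf \<Rightarrow> nat \<Rightarrow> real" where
  "return_probability G \<mu> t = pmf (convolution_power G \<mu> t) \<one>\<^bsub>G\<^esub>"

section \<open>The Hilbert space of square-summable functions on a group\<close>

text \<open>Functions on the group are extended by zero off the carrier.\<close>

definition ell2 :: "('a, 'b) monoid_scheme \<Rightarrow> ('a \<Rightarrow> complex) set" where
  "ell2 G = {f. (\<forall>x. x \<notin> carrier G \<longrightarrow> f x = 0) \<and>
                (\<lambda>x. (cmod (f x))\<^sup>2) summable_on carrier G}"

definition ell2_inner ::
  "('a, 'b) monoid_scheme \<Rightarrow> ('a \<Rightarrow> complex) \<Rightarrow> ('a \<Rightarrow> complex) \<Rightarrow> complex" where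
  "ell2_inner G f g = (\<Sum>\<^sub>\<infinity>x\<in>carrier G. f x * cnj (g x))"

definition ell2_norm :: "('a, 'b) monoid_scheme \<Rightarrow> ('a \<Rightarrow> complex) \<Rightarrow> real" where
  "ell2_norm G f = sqrt (\<Sum>\<^sub>\<infinity>x\<in>carrier G. (cmod (f x))\<^sup>2)"

definition ell2_delta :: "'a \<Rightarrow> 'a \<Rightarrow> complex" where
  "ell2_delta a x = (if x = a then 1 else 0)"

definition bounded_operator ::
  "('a, 'b) monoid_scheme \<Rightarrow> (('a \<Rightarrow> complex) \<Rightarrow> ('a \<Rightarrow> complex)) \<Rightarrow> bool" where
  "bounded_operator G P \<longleftrightarrow>
     (\<forall>f\<in>ell2 G. P f \<in> ell2 G) \<and>
     (\<forall>f\<in>ell2 G. \<forall>g\<in>ell2 G. P (\<lambda>x. f x + g x) = (\<lambda>x. P f x + P g x)) \<and>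
     (\<forall>c. \<forall>f\<in>ell2 G. P (\<lambda>x. c * f x) = (\<lambda>x. c * P f x)) \<and>
     (\<exists>K. \<forall>f\<in>ell2 G. ell2_norm G (P f) \<le> K * ell2_norm G f)"

section \<open>Borel functional calculus\<close>

text \<open>
  For a bounded self-adjoint operator \<open>T\<close> and a vector \<open>\<psi>\<close>, the spectral measure of \<open>T\<close> at
  \<open>\<psi>\<close> is the unique compactly supported finite Borel measure \<open>m\<close> on the real line with
  \<open>\<langle>p(T)\<psi>, \<psi>\<rangle> = \<integral> p dm\<close> for all polynomials \<open>p\<close>. For a bounded Borel function \<open>h\<close>, the operator
  \<open>h(T)\<close> is then the bounded operator with \<open>\<langle>h(T)\<psi>, \<psi>\<rangle> = \<integral> h dm\<close> for all \<open>\<psi>\<close>, which is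
  determined by polarization (Reed and Simon, Methods of Modern Mathematical Physics I,
  Section VII.2). Extensionality makes \<open>h(T)\<close> unique as a function on the whole type.
\<close>

definition is_spectral_measure_at ::
  "('a, 'b) monoid_scheme \<Rightarrow> (('a \<Rightarrow> complex) \<Rightarrow> ('a \<Rightarrow> complex)) \<Rightarrow> ('a \<Rightarrow> complex) \<Rightarrow>
   real measure \<Rightarrow> bool" where
  "is_spectral_measure_at G T \<psi> m \<longleftrightarrow>
     finite_measure m \<and> sets m = sets borel \<and> (\<exists>K. AE x in m. \<bar>x\<bar> \<le> K) \<and>
     (\<forall>n. ell2_inner G ((T ^^ n) \<psi>) \<psi> = complex_of_real (\<integral>x. x ^ n \<partial>m))"

definition spectral_measure_at ::
  "('a, 'b) monoid_scheme \<Rightarrow> (('a \<Rightarrow> complex) \<Rightarrow> ('a \<Rightarrow> complex)) \<Rightarrow> ('a \<Rightarrow> complex) \<Rightarrow>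
   real measure" where
  "spectral_measure_at G T \<psi> = (THE m. is_spectral_measure_at G T \<psi> m)"

definition borel_calculus ::
  "('a, 'b) monoid_scheme \<Rightarrow> (('a \<Rightarrow> complex) \<Rightarrow> ('a \<Rightarrow> complex)) \<Rightarrow> (real \<Rightarrow> real) \<Rightarrow>
   (('a \<Rightarrow> complex) \<Rightarrow> ('a \<Rightarrow> complex))" where
  "borel_calculus G T h =
     (THE P. bounded_operator G P \<and> P \<in> extensional (ell2 G) \<and>
        (\<forall>\<psi>\<in>ell2 G. ell2_inner G (P \<psi>) \<psi> =
           complex_of_real (\<integral>x. h x \<partial>spectral_measure_at G T \<psi>)))"

section \<open>The spectral distribution\<close>

definition markov_operator ::
  "('a, 'b) monoid_scheme \<Rightarrow> 'a pmf \<Rightarrow> ('a \<Rightarrow> complex) \<Rightarrow> ('a \<Rightarrow> complex)" where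
  "markov_operator G \<mu> f x =
     (if x \<in> carrier G
      then \<Sum>\<^sub>\<infinity>g\<in>carrier G. f (x \<otimes>\<^bsub>G\<^esub> inv\<^bsub>G\<^esub> g) * complex_of_real (pmf \<mu> g)
      else 0)"

definition laplace_operator ::
  "('a, 'b) monoid_scheme \<Rightarrow> 'a pmf \<Rightarrow> ('a \<Rightarrow> complex) \<Rightarrow> ('a \<Rightarrow> complex)" where
  "laplace_operator G \<mu> f = (\<lambda>x. f x - markov_operator G \<mu> f x)"

definition spectral_distribution ::
  "('a, 'b) monoid_scheme \<Rightarrow> 'a pmf \<Rightarrow> real \<Rightarrow> real" where
  "spectral_distribution G \<mu> s =
     Re (ell2_inner G
           (borel_calculus G (laplace_operator G \<mu>) (indicat_real {..s}) (ell2_delta \<one>\<^bsub>G\<^esub>))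
           (ell2_delta \<one>\<^bsub>G\<^esub>))"

text \<open>
  The Stieltjes integral over \<open>[0, \<infinity>)\<close> with respect to \<open>F\<close>. Extending \<open>F\<close> by zero to the left
  of the origin gives the point 0 the mass \<open>F 0\<close>.
\<close>

definition stieltjes_integral :: "(real \<Rightarrow> real) \<Rightarrow> (real \<Rightarrow> real) \<Rightarrow> real" where
  "stieltjes_integral F h =
     (LINT x:{0..}|interval_measure (\<lambda>x. if 0 \<le> x then F x else 0). h x)"

section \<open>Asymptotic comparison near infinity\<close>

definition asymp_le :: "(real \<Rightarrow> real) \<Rightarrow> (real \<Rightarrow> real) \<Rightarrow> bool" where
  "asymp_le f g \<longleftrightarrow>
     (\<exists>C>0. \<exists>D>0. \<exists>x0>0. \<forall>x\<ge>x0. f x \<le> C * g (D * x))"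

definition asymp_equiv_dilated :: "(real \<Rightarrow> real) \<Rightarrow> (real \<Rightarrow> real) \<Rightarrow> bool" where
  "asymp_equiv_dilated f g \<longleftrightarrow> asymp_le f g \<and> asymp_le g f"

text \<open>Only the values at nonnegative reals are meaningful.\<close>

definition piecewise_linear_ext :: "(nat \<Rightarrow> real) \<Rightarrow> real \<Rightarrow> real" where
  "piecewise_linear_ext a x =
     (1 - frac x) * a (nat \<lfloor>x\<rfloor>) + frac x * a (nat \<lfloor>x\<rfloor> + 1)"

end

theory Submission
  imports Defs "HOL-Real_Asymp.Real_Asymp"
begin

text \<open>
  The spectral theorem at the unit vector gives a probability measure \<open>m\<close> on \<open>[0, 2]\<close> whose
  distribution function is \<open>N\<close> and with \<open>p n = \<integral> (1 - s)^n dm\<close>, so the two functions to be compared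
  are two integral transforms of \<open>m\<close>.

  Upper bound: \<open>p (2 t) \<le> p (2 t) + p (2 t - 1)\<close>, and \<open>(1 - s)^(2 t) + (1 - s)^(2 t - 1)\<close> is at most
  \<open>2 exp (- s t)\<close> for \<open>s \<le> 1\<close> and nonpositive for \<open>s > 1\<close>.

  Lower bound: \<open>exp (- 2 s) \<le> 1 - s\<close> on \<open>[0, 1/2]\<close>, and the rest of the Laplace transform at \<open>n\<close> is at
  most \<open>exp (- n / 2)\<close>. As \<open>p (2 k) \<ge> p 2 ^ k\<close> by convexity, this is absorbed by \<open>p (2 k)\<close> as soon
  as \<open>n \<ge> q k\<close> with a large constant \<open>q\<close>, which the dilation in the comparison provides.

  The spectral measure of an operator \<open>0 \<le> S \<le> 1\<close> at a vector comes from Hausdorff's moment theorem,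
  since \<open>S^k (1 - S)^l\<close> is positive. If polynomials \<open>p n\<close> converge boundedly to the indicator of
  \<open>{..s}\<close>, then \<open>p n (S)\<close> converges strongly, by dominated convergence for the spectral measures,
  and the limit is the spectral projection.
\<close>

section \<open>The Hausdorff moment problem\<close>

text \<open>The ratio is the product over \<open>i < j\<close> of \<open>(k - i) / (n - i)\<close>,
  to be compared with j copies of \<open>k / n\<close>. As all factors have absolute value at most
  1, the products differ by at most the sum of the factorwise differences, each at most
  \<open>i / (n - i)\<close>.\<close>

lemma binomial_ratio_diff_le:
  fixes j k n :: nat
  assumes "k \<le> n" "2 * j < n"
  shows "\<bar>real (k choose j) / real (n choose j) - (real k / real n) ^ j\<bar> \<le> real (j * j) / real (n - j)"
proof -
  have n: "real n > 0" "\<And>i. i < j \<Longrightarrow> real n - real i > 0"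
    using assms by auto
  have "real (k choose j) / real (n choose j) = (\<Prod>i<j. (real k - real i) / (real n - real i))"
    unfolding binomial_gbinomial gbinomial_prod_rev prod_dividef by (simp add: atLeast0LessThan)
  moreover have "(real k / real n) ^ j = (\<Prod>i<j. real k / real n)"
    by simp
  moreover have "norm ((\<Prod>i<j. (real k - real i) / (real n - real i)) - (\<Prod>i<j. real k / real n))
      \<le> (\<Sum>i<j. norm ((real k - real i) / (real n - real i) - real k / real n))"
  proof (rule norm_prod_diff)
    fix i assume i: "i \<in> {..<j}"
    \<comment> \<open>For \<open>k < i\<close> the factor is negative; then \<open>2 * j < n\<close>
      gives \<open>i - k \<le> n - i\<close>.\<close>
    show "norm ((real k - real i) / (real n - real i)) \<le> 1"
      using assms i n(2)[of i] by (auto simp: field_simps abs_le_iff)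
    show "norm (real k / real n) \<le> 1"
      using assms by (auto simp: field_simps)
  qed
  moreover have "(\<Sum>i<j. norm ((real k - real i) / (real n - real i) - real k / real n))
      \<le> (\<Sum>i<j. real j / real (n - j))"
  proof (rule sum_mono)
    fix i assume i: "i \<in> {..<j}"
    have "(real k - real i) / (real n - real i) - real k / real n
        = - (real i / (real n - real i) * ((real n - real k) / real n))"
      using n(1) n(2)[of i] i by (simp add: field_simps)
    also have "norm \<dots> = real i / (real n - real i) * ((real n - real k) / real n)"
      using n(1) n(2)[of i] i assms by (simp add: abs_mult)
    also have "\<dots> \<le> real i / (real n - real i)"
      using n(1) n(2)[of i] i assms by (intro mult_left_le) (auto simp: field_simps)
    also have "\<dots> \<le> real j / real (n - j)"
      using i assms by (intro frac_le) (auto simp: of_nat_diff)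
    finally show "norm ((real k - real i) / (real n - real i) - real k / real n) \<le> real j / real (n - j)" .
  qed
  ultimately show ?thesis by simp
qed

text \<open>This is the j-th factorial moment of the binomial distribution, divided by j!. A
  commutative ring is used because X and Y will be the polynomials x and 1 - x, to which a linear
  functional is then applied.\<close>

lemma sum_binomial_moment:
  fixes X Y :: "'a::comm_ring_1"
  assumes "X + Y = 1" "j \<le> n"
  shows "(\<Sum>k\<le>n. of_nat (k choose j) * (of_nat (n choose k) * X ^ k * Y ^ (n - k)))
    = of_nat (n choose j) * X ^ j"
proof -
  have "(\<Sum>k\<le>n. of_nat (k choose j) * (of_nat (n choose k) * X ^ k * Y ^ (n - k)))
    = (\<Sum>k\<in>{j..n}. of_nat (k choose j) * (of_nat (n choose k) * X ^ k * Y ^ (n - k)))"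
    by (rule sum.mono_neutral_right) (auto simp: binomial_eq_0)
  also have "\<dots> = (\<Sum>k\<in>{j..n}. of_nat (n choose j) * X ^ j *
      (of_nat ((n - j) choose (k - j)) * X ^ (k - j) * Y ^ (n - j - (k - j))))"
  proof (rule sum.cong[OF refl])
    fix k assume k: "k \<in> {j..n}"
    have *: "(of_nat (n choose k) * of_nat (k choose j) :: 'a)
        = of_nat (n choose j) * of_nat ((n - j) choose (k - j))"
      using choose_mult[of j k n] k by (metis atLeastAtMost_iff of_nat_mult)
    have "of_nat (k choose j) * (of_nat (n choose k) * X ^ k * Y ^ (n - k)) =
        (of_nat (n choose k) * of_nat (k choose j)) * X ^ k * Y ^ (n - k)"
      by (simp only: mult_ac)
    also have "\<dots> = of_nat (n choose j) * of_nat ((n - j) choose (k - j)) *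
        (X ^ j * X ^ (k - j)) * Y ^ (n - j - (k - j))"
      unfolding * using k by (simp flip: power_add)
    finally show "of_nat (k choose j) * (of_nat (n choose k) * X ^ k * Y ^ (n - k)) =
       of_nat (n choose j) * X ^ j *
      (of_nat ((n - j) choose (k - j)) * X ^ (k - j) * Y ^ (n - j - (k - j)))"
      by (simp only: mult_ac)
  qed
  also have "\<dots> = (\<Sum>k\<le>n - j. of_nat (n choose j) * X ^ j *
      (of_nat ((n - j) choose k) * X ^ k * Y ^ (n - j - k)))"
    using assms(2)
    by (intro sum.reindex_bij_witness[of _ "\<lambda>k. k + j" "\<lambda>k. k - j"]) auto
  also have "\<dots> = of_nat (n choose j) * X ^ j * (X + Y) ^ (n - j)"
    by (simp add: binomial_ring sum_distrib_left)
  finally show ?thesis using assms(1) by simp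
qed

lemma finite_weights_pmf:
  fixes w :: "'a \<Rightarrow> real"
  assumes "finite A" "\<And>k. k \<in> A \<Longrightarrow> 0 \<le> w k" "(\<Sum>k\<in>A. w k) = 1"
  obtains p where "\<And>k. pmf p k = (if k \<in> A then w k else 0)"
proof
  let ?f = "\<lambda>k. if k \<in> A then w k else 0"
  fix k
  show "pmf (embed_pmf ?f) k = ?f k"
  proof (rule pmf_embed_pmf)
    have "(\<integral>\<^sup>+ x. ennreal (?f x) \<partial>count_space UNIV) = (\<Sum>x\<in>A. ennreal (?f x))"
      using assms by (intro nn_integral_count_space') auto
    also have "\<dots> = ennreal (\<Sum>x\<in>A. w x)"
      using assms(2) by (subst sum_ennreal[symmetric]) auto
    finally show "(\<integral>\<^sup>+ x. ennreal (?f x) \<partial>count_space UNIV) = 1"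
      using assms by simp
  qed (use assms in auto)
qed

text \<open>
  The Bernstein weights \<open>L ((n choose k) x^k (1 - x)^(n - k))\<close>, placed at the points \<open>k / n\<close>, form a
  tight sequence of distributions; Helly's theorem extracts the measure.
\<close>

theorem hausdorff_moment:
  fixes L :: "real poly \<Rightarrow> real"
  assumes add: "\<And>p q. L (p + q) = L p + L q"
    and smult: "\<And>c p. L (smult c p) = c * L p"
    and pos: "\<And>k l. 0 \<le> L ([:0, 1:] ^ k * [:1, -1:] ^ l)"
    and one: "L 1 = 1"
  obtains M where "real_distribution M" "AE x in M. 0 \<le> x \<and> x \<le> 1"
    "\<And>j. (\<integral>x. x ^ j \<partial>M) = L ([:0, 1:] ^ j)"
proof -
  let ?X = "[:0, 1:] :: real poly" and ?Y = "[:1, -1:] :: real poly"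
  have zero: "L 0 = 0" using smult[of 0 0] by simp
  have Lsum: "L (\<Sum>i\<in>A. f i) = (\<Sum>i\<in>A. L (f i))" for f and A :: "nat set"
    by (induction A rule: infinite_finite_induct) (auto simp: zero add)
  have of_nat: "L (of_nat m * p) = real m * L p" for m p
    using smult[of "real m" p] by (simp add: of_nat_poly)
  define w where "w n k = L (of_nat (n choose k) * ?X ^ k * ?Y ^ (n - k))" for n k
  have w_nonneg: "0 \<le> w n k" for n k
    unfolding w_def using pos[of k "n - k"] of_nat[of "n choose k"] by (simp add: mult.assoc)
  have mom: "(\<Sum>k\<le>n. real (k choose j) * w n k) = real (n choose j) * L (?X ^ j)" if "j \<le> n" for n j
    using sum_binomial_moment[of ?X ?Y j n, THEN arg_cong[where f=L]] that
    by (simp add: Lsum of_nat w_def)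
  have w_sum: "(\<Sum>k\<le>n. w n k) = 1" for n
    using mom[of 0 n] one by simp
  have "\<exists>p. \<forall>k. pmf p k = (if k \<in> {..n} then w n k else 0)" for n
    by (rule finite_weights_pmf[of "{..n}" "w n"]) (use w_nonneg w_sum in blast)+
  then obtain p where p: "\<And>n k. pmf (p n) k = (if k \<le> n then w n k else 0)"
    by (metis atMost_iff)
  have set_p: "set_pmf (p n) \<subseteq> {..n}" for n
    by (auto simp: set_pmf_iff p split: if_splits)
  define \<nu> where "\<nu> n = distr (measure_pmf (p n)) borel (\<lambda>k. real k / real n)" for n
  have real_dist: "real_distribution (\<nu> n)" for n
    unfolding \<nu>_def by (rule prob_space.real_distribution_distr) (auto simp: measure_pmf.prob_space_axioms)
  have integral_\<nu>: "(\<integral>x. f x \<partial>\<nu> n) = (\<Sum>k\<le>n. f (real k / real n) * w n k)"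
    if "f \<in> borel_measurable borel" for f n
  proof -
    have "(\<integral>x. f x \<partial>\<nu> n) = (\<integral>k. f (real k / real n) \<partial>measure_pmf (p n))"
      unfolding \<nu>_def by (rule integral_distr) (use that in auto)
    also have "\<dots> = (\<Sum>k\<le>n. f (real k / real n) * pmf (p n) k)"
      by (rule integral_measure_pmf_real) (use set_p in auto)
    finally show ?thesis by (simp add: p)
  qed
  \<comment> \<open>Weak convergence only tests bounded continuous functions, which powers of x are
    not. Clamping to [0, 1] makes them bounded and changes nothing at the atoms
    \<open>k / n\<close>.\<close>
  define c where "c x = max 0 (min 1 x)" for x :: real
  have c_frac: "c (real k / real n) = real k / real n" if "k \<le> n" for k n
  proof -
    have "0 \<le> real k / real n" "real k / real n \<le> 1"
      using that by (auto simp: divide_le_eq_1)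
    then show ?thesis by (simp add: c_def)
  qed
  have c_range: "0 \<le> c x" "c x \<le> 1" for x
    by (auto simp: c_def)
  have [continuous_intros]: "isCont c x" for x
    unfolding c_def by (intro continuous_intros)
  have [measurable]: "c \<in> borel_measurable borel"
    unfolding c_def by measurable
  \<comment> \<open>Tightness is stated with intervals open on the left, so the left end must lie
    below the possible atom at 0.\<close>
  have "measure (\<nu> n) {-1<..1} = 1" for n
  proof -
    have "measure (\<nu> n) {-1<..1} = measure (measure_pmf (p n)) ((\<lambda>k. real k / real n) -` {-1<..1})"
      unfolding \<nu>_def by (subst measure_distr) auto
    also have "\<dots> = 1"
    proof (subst measure_pmf.prob_eq_1)
      have "-1 < real k / real n \<and> real k / real n \<le> 1" if "k \<in> set_pmf (p n)" for k
        using c_frac[of k n] c_range[of "real k / real n"] set_p[of n] that by (smt (verit) atMost_iff subsetD)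
      then show "AE k in measure_pmf (p n). k \<in> (\<lambda>k. real k / real n) -` {-1<..1}"
        by (simp add: AE_measure_pmf_iff)
    qed simp
    finally show ?thesis .
  qed
  then have "tight \<nu>"
    unfolding tight_def using real_dist
    by (intro conjI allI impI exI[of _ "-1"] exI[of _ 1]) auto
  then obtain r M where r: "strict_mono r" and M: "real_distribution M"
    and conv: "weak_conv_m (\<nu> \<circ> (\<lambda>n. n) \<circ> r) M"
    using tight_imp_convergent_subsubsequence[of \<nu> "\<lambda>n. n"] by (auto simp: strict_mono_def)
  interpret M: real_distribution M by fact
  have lim: "(\<lambda>n. \<integral>x. f x \<partial>\<nu> (r n)) \<longlonglongrightarrow> (\<integral>x. f x \<partial>M)"
    if "\<And>x. isCont f x" "\<And>x. norm (f x) \<le> B" for f :: "real \<Rightarrow> real" and B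
    using weak_conv_imp_integral_bdd_continuous_conv[OF _ M conv, of f B] that real_dist by simp
  \<comment> \<open>A bounded continuous function that vanishes exactly on [0, 1]. Its integral is 0
    for every member of the sequence, hence for the limit, which is therefore carried by
    [0, 1].\<close>
  define e where "e x = min 1 \<bar>x - c x\<bar>" for x :: real
  have [measurable]: "e \<in> borel_measurable borel" unfolding e_def by measurable
  have "(\<lambda>n. \<integral>x. e x \<partial>\<nu> (r n)) \<longlonglongrightarrow> (\<integral>x. e x \<partial>M)"
    by (rule lim[of _ 1]) (auto simp: e_def intro!: continuous_intros)
  moreover have "(\<integral>x. e x \<partial>\<nu> n) = 0" for n
    by (subst integral_\<nu>) (simp_all add: e_def c_frac)
  ultimately have "(\<integral>x. e x \<partial>M) = 0"
    by (simp add: LIMSEQ_const_iff)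
  then have "AE x in M. e x = 0"
    by (subst (asm) integral_nonneg_eq_0_iff_AE)
      (auto simp: e_def intro!: M.integrable_const_bound[where B=1])
  then have supp: "AE x in M. c x = x"
    by eventually_elim (auto simp: e_def min_def split: if_splits)
  have "(\<integral>x. x ^ j \<partial>M) = L (?X ^ j)" for j
  proof -
    have "(\<integral>x. x ^ j \<partial>M) = (\<integral>x. c x ^ j \<partial>M)"
      by (rule integral_cong_AE) (use supp in auto)
    moreover have "(\<lambda>n. \<integral>x. c x ^ j \<partial>\<nu> (r n)) \<longlonglongrightarrow> (\<integral>x. c x ^ j \<partial>M)"
      by (rule lim[of _ 1]) (auto intro!: continuous_intros power_le_one simp: c_range)
    moreover have "(\<lambda>n. \<integral>x. c x ^ j \<partial>\<nu> (r n)) \<longlonglongrightarrow> L (?X ^ j)"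
    proof -
      have bd: "\<bar>(\<integral>x. c x ^ j \<partial>\<nu> n) - L (?X ^ j)\<bar> \<le> real (j * j) / real (n - j)" if n: "2 * j < n" for n
      proof -
        \<comment> \<open>By the factorial moments, \<open>L (?X ^ j)\<close> is the mean of the
          binomial ratio under the weights, while the integral is the mean of
          \<open>(k / n) ^ j\<close>.\<close>
        have "L (?X ^ j) = (\<Sum>k\<le>n. real (k choose j) / real (n choose j) * w n k)"
          using mom[of j n] n by (simp add: field_simps flip: sum_divide_distrib)
        then have "\<bar>(\<integral>x. c x ^ j \<partial>\<nu> n) - L (?X ^ j)\<bar>
            = \<bar>\<Sum>k\<le>n. ((real k / real n) ^ j - real (k choose j) / real (n choose j)) * w n k\<bar>"
          by (subst integral_\<nu>) (auto simp: c_frac left_diff_distrib sum_subtractf)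
        also have "\<dots> \<le> (\<Sum>k\<le>n. real (j * j) / real (n - j) * w n k)"
        proof (intro order_trans[OF sum_abs] sum_mono)
          fix k assume "k \<in> {..n}"
          then have "\<bar>(real k / real n) ^ j - real (k choose j) / real (n choose j)\<bar>
              \<le> real (j * j) / real (n - j)"
            using binomial_ratio_diff_le[of k n j] n by (simp add: abs_minus_commute)
          then show "\<bar>((real k / real n) ^ j - real (k choose j) / real (n choose j)) * w n k\<bar>
              \<le> real (j * j) / real (n - j) * w n k"
            unfolding abs_mult abs_of_nonneg[OF w_nonneg] by (rule mult_right_mono[OF _ w_nonneg])
        qed
        also have "\<dots> = real (j * j) / real (n - j)"
          unfolding sum_distrib_left[symmetric] w_sum by simp
        finally show ?thesis .
      qed
      have "(\<lambda>n. real (j * j) / real (n - j)) \<longlonglongrightarrow> 0"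
        by real_asymp
      then have "(\<lambda>n. (\<integral>x. c x ^ j \<partial>\<nu> n) - L (?X ^ j)) \<longlonglongrightarrow> 0"
      proof (rule Lim_null_comparison[rotated])
        show "\<forall>\<^sub>F n in sequentially. norm ((\<integral>x. c x ^ j \<partial>\<nu> n) - L (?X ^ j)) \<le> real (j * j) / real (n - j)"
          unfolding real_norm_def by (rule eventually_sequentiallyI[of "2 * j + 1"], rule bd) simp
      qed
      then have "(\<lambda>n. \<integral>x. c x ^ j \<partial>\<nu> n) \<longlonglongrightarrow> L (?X ^ j)"
        by (simp add: LIM_zero_iff)
      from LIMSEQ_subseq_LIMSEQ[OF this r] show ?thesis by (simp add: o_def)
    qed
    ultimately show ?thesis by (metis (lifting) LIMSEQ_unique)
  qed
  moreover have "AE x in M. 0 \<le> x \<and> x \<le> 1"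
    using supp by eventually_elim (metis c_range)
  ultimately show ?thesis using that M by blast
qed

section \<open>Compactly supported measures and polynomials\<close>

text \<open>The ramps \<open>f n\<close> are 1 up to s and fall to 0 with slope -n, so they converge
  pointwise to the indicator, including the value 1 at s. Weierstrass approximation within
  \<open>1 / (n + 1)\<close> turns them into polynomials and raises the bound from 1 to at most
  2.\<close>

lemma polys_tendsto_indicator_atMost:
  fixes K s :: real
  obtains p :: "nat \<Rightarrow> real poly" where "\<And>n x. \<bar>x\<bar> \<le> K \<Longrightarrow> \<bar>poly (p n) x\<bar> \<le> 2"
    "\<And>x. \<bar>x\<bar> \<le> K \<Longrightarrow> (\<lambda>n. poly (p n) x) \<longlonglongrightarrow> indicator {..s} x"
proof -
  define f where "f n x = max 0 (min 1 (1 - real n * (x - s)))" for n x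
  have "\<exists>p. \<forall>x\<in>{-K..K}. \<bar>f n x - poly p x\<bar> < 1 / real (Suc n)" for n
  proof -
    have "continuous_on {-K..K} (f n)"
      unfolding f_def by (intro continuous_intros)
    then obtain g where "real_polynomial_function g"
      and g: "\<And>x. x \<in> {-K..K} \<Longrightarrow> \<bar>f n x - g x\<bar> < 1 / real (Suc n)"
      by (rule Stone_Weierstrass_real_polynomial_function[rotated, of _ _ "1 / real (Suc n)"]) auto
    then obtain a m where "g = (\<lambda>x. \<Sum>i\<le>m. a i * x ^ i)"
      using real_polynomial_function_imp_sum by blast
    then have "g = poly (\<Sum>i\<le>m. monom (a i) i)"
      by (auto simp: poly_sum poly_monom)
    then show ?thesis using g by blast
  qed
  then obtain p where p: "\<And>n x. \<bar>x\<bar> \<le> K \<Longrightarrow> \<bar>f n x - poly (p n) x\<bar> < 1 / real (Suc n)"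
    by (metis (no_types) abs_le_iff atLeastAtMost_iff minus_le_iff)
  show ?thesis
  proof
    fix n x assume x: "\<bar>x\<bar> \<le> K"
    have "0 \<le> f n x" "f n x \<le> 1" unfolding f_def by auto
    moreover have "1 / real (Suc n) \<le> 1" by simp
    ultimately show "\<bar>poly (p n) x\<bar> \<le> 2" using p[OF x, of n] by linarith
  next
    fix x assume x: "\<bar>x\<bar> \<le> K"
    have "(\<lambda>n. f n x - poly (p n) x) \<longlonglongrightarrow> 0"
      by (rule Lim_null_comparison[OF _ LIMSEQ_inverse_real_of_nat])
        (use p[OF x] in \<open>auto intro!: always_eventually less_imp_le simp: inverse_eq_divide\<close>)
    moreover have "(\<lambda>n. f n x) \<longlonglongrightarrow> indicator {..s} x"
    proof (cases "x \<le> s")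
      case True
      then have "1 \<le> 1 - real n * (x - s)" for n
        using mult_nonneg_nonpos[of "real n" "x - s"] by simp
      then show ?thesis using True by (simp add: f_def)
    next
      case False
      obtain N :: nat where N: "1 / (x - s) < real N" using reals_Archimedean2 by blast
      have "f n x = 0" if "n \<ge> N" for n
      proof -
        have "1 < real N * (x - s)" using N False by (simp add: field_simps)
        also have "\<dots> \<le> real n * (x - s)" using that False by (intro mult_right_mono) auto
        finally show ?thesis by (simp add: f_def)
      qed
      then have "eventually (\<lambda>n. f n x = 0) sequentially"
        by (auto simp: eventually_sequentially)
      then show ?thesis using False by (simp add: tendsto_eventually)
    qed
    ultimately show "(\<lambda>n. poly (p n) x) \<longlonglongrightarrow> indicator {..s} x"
      using tendsto_diff by fastforce
  qed
qed

context
  fixes m :: "real measure" and K :: real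
  assumes fin: "finite_measure m" and sets_m: "sets m = sets borel"
    and supp: "AE x in m. \<bar>x\<bar> \<le> K"
begin

interpretation finite_measure m by (rule fin)

lemma borel_measurable_poly_measure: "poly p \<in> borel_measurable m" for p :: "real poly"
  unfolding measurable_cong_sets[OF sets_m refl]
  by (intro borel_measurable_continuous_onI continuous_intros)

lemma integrable_poly_measure: "integrable m (poly p)" for p :: "real poly"
proof -
  have "bounded (poly p ` {-K..K})"
    by (intro compact_imp_bounded compact_continuous_image continuous_intros) auto
  then obtain B where B: "\<And>x. x \<in> {-K..K} \<Longrightarrow> norm (poly p x) \<le> B"
    by (metis bounded_iff imageI)
  have "AE x in m. norm (poly p x) \<le> B"
    using supp by eventually_elim (rule B, auto)
  then show ?thesis
    by (rule integrable_const_bound[OF _ borel_measurable_poly_measure])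
qed

lemma integrable_power_measure: "integrable m (\<lambda>x. x ^ n)"
proof -
  have "poly (monom 1 n) = (\<lambda>x::real. x ^ n)"
    by (simp add: fun_eq_iff poly_monom)
  then show ?thesis
    using integrable_poly_measure[of "monom 1 n"] by simp
qed

lemma integral_poly_measure:
  "(\<integral>x. poly p x \<partial>m) = (\<Sum>i\<le>degree p. coeff p i * (\<integral>x. x ^ i \<partial>m))"
  unfolding poly_altdef using integrable_power_measure by simp

lemma integral_polys_tendsto_measure_atMost:
  assumes "\<And>n x. \<bar>x\<bar> \<le> K \<Longrightarrow> \<bar>poly (p n) x\<bar> \<le> 2"
    "\<And>x. \<bar>x\<bar> \<le> K \<Longrightarrow> (\<lambda>n. poly (p n) x) \<longlonglongrightarrow> indicator {..s} x"
  shows "(\<lambda>n. \<integral>x. poly (p n) x \<partial>m) \<longlonglongrightarrow> measure m {..s}"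
proof -
  have "(\<lambda>n. \<integral>x. poly (p n) x \<partial>m) \<longlonglongrightarrow> (\<integral>x. indicator {..s} x \<partial>m)"
  proof (rule integral_dominated_convergence[where w="\<lambda>_. 2"])
    show "AE x in m. (\<lambda>n. poly (p n) x) \<longlonglongrightarrow> indicator {..s} x"
      using supp by eventually_elim (rule assms(2))
    show "AE x in m. norm (poly (p n) x) \<le> 2" for n
      using supp by eventually_elim (use assms(1) in auto)
    show "(\<lambda>x. indicator {..s} x :: real) \<in> borel_measurable m"
      by (rule borel_measurable_indicator) (simp add: sets_m)
  qed (auto simp: borel_measurable_poly_measure)
  then show ?thesis using sets_eq_imp_space_eq[OF sets_m] by simp
qed

end

text \<open>Moments determine the integrals of polynomials, and polynomials that converge boundedly
  to half-line indicators determine the distribution function. This uniqueness makes the definite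
  description in \<open>spectral_measure_at\<close> meaningful.\<close>

theorem compact_support_measure_eqI:
  fixes m m' :: "real measure"
  assumes m: "finite_measure m" "sets m = sets borel" "AE x in m. \<bar>x\<bar> \<le> K"
    and m': "finite_measure m'" "sets m' = sets borel" "AE x in m'. \<bar>x\<bar> \<le> K'"
    and moments: "\<And>n. (\<integral>x. x ^ n \<partial>m) = (\<integral>x. x ^ n \<partial>m')"
  shows "m = m'"
proof (rule cdf_unique')
  show "finite_borel_measure m" "finite_borel_measure m'"
    using m m' by (auto simp: finite_borel_measure_def finite_borel_measure_axioms_def)
  let ?K = "max K K'"
  have mK: "AE x in m. \<bar>x\<bar> \<le> ?K" and mK': "AE x in m'. \<bar>x\<bar> \<le> ?K"
    using m(3) m'(3) by (auto elim!: eventually_mono)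
  show "cdf m = cdf m'"
  proof
    fix s
    obtain p :: "nat \<Rightarrow> real poly" where p: "\<And>n x. \<bar>x\<bar> \<le> ?K \<Longrightarrow> \<bar>poly (p n) x\<bar> \<le> 2"
      "\<And>x. \<bar>x\<bar> \<le> ?K \<Longrightarrow> (\<lambda>n. poly (p n) x) \<longlonglongrightarrow> indicator {..s} x"
      by (rule polys_tendsto_indicator_atMost[of ?K s]) blast
    have "(\<lambda>n. \<integral>x. poly (p n) x \<partial>m) \<longlonglongrightarrow> measure m {..s}"
      using p by (rule integral_polys_tendsto_measure_atMost[OF m(1,2) mK])
    moreover have "(\<lambda>n. \<integral>x. poly (p n) x \<partial>m') \<longlonglongrightarrow> measure m' {..s}"
      using p by (rule integral_polys_tendsto_measure_atMost[OF m'(1,2) mK'])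
    moreover have "(\<integral>x. poly (p n) x \<partial>m) = (\<integral>x. poly (p n) x \<partial>m')" for n
      unfolding integral_poly_measure[OF m(1,2) mK] integral_poly_measure[OF m'(1,2) mK'] moments ..
    ultimately show "cdf m s = cdf m' s"
      unfolding cdf_def by (simp add: LIMSEQ_unique)
  qed
qed

section \<open>Spectral projections of positive operators\<close>

text \<open>Evaluation of a real polynomial at an operator by Horner's scheme.\<close>

definition poly_op :: "('h \<Rightarrow> 'h) \<Rightarrow> real poly \<Rightarrow> 'h \<Rightarrow> 'h::real_vector" where
  "poly_op T p = fold_coeffs (\<lambda>a f x. a *\<^sub>R x + T (f x)) p (\<lambda>x. 0)"

lemma fun_poly_mult: "poly (p * q) = (\<lambda>x. poly p x * poly q x)"
  by (simp add: fun_eq_iff)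

lemma poly_op_0 [simp]: "poly_op T 0 x = 0"
  by (simp add: poly_op_def)

locale symmetric_operator =
  fixes T :: "'h::real_inner \<Rightarrow> 'h"
  assumes bounded_linear: "bounded_linear T"
    and sym: "inner (T x) y = inner x (T y)"
begin

sublocale bounded_linear T by (rule bounded_linear)

lemma poly_op_pCons [simp]: "poly_op T (pCons a p) x = a *\<^sub>R x + T (poly_op T p x)"
  by (cases "p = 0 \<and> a = 0") (auto simp: poly_op_def zero)

lemma poly_op_add: "poly_op T (p + q) x = poly_op T p x + poly_op T q x"
proof (induction p q rule: poly_induct2)
  case (pCons a p b q)
  then show ?case by (simp add: add scaleR_add_left)
qed simp

lemma poly_op_smult: "poly_op T (smult c p) x = c *\<^sub>R poly_op T p x"
  by (induction p) (auto simp: scaleR scaleR_add_right)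

lemma poly_op_diff: "poly_op T (p - q) x = poly_op T p x - poly_op T q x"
  using poly_op_add[of "p - q" q x] by simp

lemma poly_op_1 [simp]: "poly_op T 1 x = x"
  by (simp add: one_pCons zero)

lemma poly_op_mult: "poly_op T (p * q) x = poly_op T p (poly_op T q x)"
  by (induction p) (auto simp: poly_op_add poly_op_smult)

lemma poly_op_power: "poly_op T (p ^ n) x = ((poly_op T p) ^^ n) x"
  by (induction n) (auto simp: poly_op_mult)

lemma bounded_linear_poly_op: "bounded_linear (poly_op T p)"
proof (induction p)
  case 0
  then show ?case by simp
next
  case (pCons a p)
  then show ?case
    by (auto intro!: bounded_linear_add bounded_linear_scaleR_right
        bounded_linear_compose[OF bounded_linear_axioms])
qed

lemma poly_op_commute:
  assumes A: "linear A" and "\<And>x. A (T x) = T (A x)"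
  shows "A (poly_op T p x) = poly_op T p (A x)"
  by (induction p) (auto simp: assms linear_add[OF A] linear_scale[OF A] linear_0[OF A])

lemma poly_op_sym: "inner (poly_op T p x) y = inner x (poly_op T p y)"
proof (induction p arbitrary: x y)
  case (pCons a p)
  have "poly_op T p (T y) = T (poly_op T p y)"
    by (rule poly_op_commute[symmetric]) (auto intro: linear)
  then show ?case by (simp add: inner_add_left inner_add_right sym pCons(2))
qed simp

lemma inner_poly_op_square_mult:
  "inner (poly_op T (q * q * p) x) x = inner (poly_op T p (poly_op T q x)) (poly_op T q x)"
  by (metis mult.assoc mult.commute poly_op_mult poly_op_sym)

lemma norm_poly_op: "(norm (poly_op T q x))\<^sup>2 = inner (poly_op T (q * q) x) x"
  using inner_poly_op_square_mult[of q 1 x] by (simp add: power2_norm_eq_inner)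

text \<open>Multiplication by a square \<open>q * q\<close> preserves positivity, because
  \<open>q\<close> can be moved to the other side of the inner product. Removing squares of X and Y
  leaves only 1, X, Y and XY, so no square root of an operator is required.\<close>

lemma bernstein_nonneg:
  assumes nonneg: "\<And>x. 0 \<le> inner (T x) x" and le: "\<And>x. inner (T x) x \<le> (norm x)\<^sup>2"
  shows "0 \<le> inner (poly_op T ([:0, 1:] ^ k * [:1, -1:] ^ l) x) x"
proof -
  let ?X = "[:0, 1:] :: real poly" and ?Y = "[:1, -1:] :: real poly"
  define N where "N p \<longleftrightarrow> (\<forall>x. 0 \<le> inner (poly_op T p x) x)" for p
  have sq: "N p \<Longrightarrow> N (q * q * p)" for p q
    by (auto simp: N_def inner_poly_op_square_mult)
  have one: "N 1" by (simp add: N_def)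
  have X: "N ?X" using nonneg by (simp add: N_def zero)
  have Y: "N ?Y" using le by (simp add: N_def inner_diff_left power2_norm_eq_inner zero neg)
  \<comment> \<open>Since X + Y = 1, the mixed product is a sum of squares times X or Y.\<close>
  have "?X * ?Y = ?X * ?X * ?Y + ?Y * ?Y * ?X" by simp
  moreover have "N (?X * ?X * ?Y + ?Y * ?Y * ?X)"
    using sq[OF Y, of ?X] sq[OF X, of ?Y] by (simp only: N_def poly_op_add inner_add_left) force
  ultimately have XY: "N (?X * ?Y)" by metis
  have "N (?X ^ k * ?Y ^ l)" for k l
  proof (induction "k + l" arbitrary: k l rule: less_induct)
    case less
    consider (1) k' where "k = Suc (Suc k')" | (2) l' where "l = Suc (Suc l')"
      | (3) "k = 0" "l = 0" | (4) "k = 1" "l = 0" | (5) "k = 0" "l = 1" | (6) "k = 1" "l = 1"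
      by (metis One_nat_def not0_implies_Suc)
    then show ?case
    proof cases
      case 1
      then have "N (?X * ?X * (?X ^ k' * ?Y ^ l))" using less by (intro sq) auto
      then show ?thesis using 1 by (simp only: power_Suc mult.assoc)
    next
      case 2
      then have "N (?Y * ?Y * (?X ^ k * ?Y ^ l'))" using less by (intro sq) auto
      then show ?thesis using 2 by (simp only: power_Suc mult_ac)
    qed (use one X Y XY in simp_all)
  qed
  then show ?thesis by (simp add: N_def)
qed

end

text \<open>The counterpart of \<open>is_spectral_measure_at\<close> in a real inner product space,
  with the support in [0, K] made explicit.\<close>

definition spectral_measure_of :: "('h \<Rightarrow> 'h::real_inner) \<Rightarrow> real \<Rightarrow> 'h \<Rightarrow> real measure \<Rightarrow> bool" where
  "spectral_measure_of T K \<psi> m \<longleftrightarrow> finite_measure m \<and> sets m = sets borel \<and>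
     (AE x in m. 0 \<le> x \<and> x \<le> K) \<and> (\<forall>n. inner ((T ^^ n) \<psi>) \<psi> = (\<integral>x. x ^ n \<partial>m))"

section \<open>Spectral measures and spectral projections of bounded positive operators\<close>

locale positive_operator = symmetric_operator T for T :: "'h::{real_inner, complete_space} \<Rightarrow> 'h" +
  fixes K :: real
  assumes nonneg: "0 \<le> inner (T x) x"
    and le: "inner (T x) x \<le> K * (norm x)\<^sup>2"
    and K_pos: "0 < K"
begin

text \<open>Rescaling to \<open>S = T / K\<close> puts the operator between 0 and 1, and division by
  the squared norm of the vector normalizes the functional, as the moment theorem requires. Both are
  undone at the end: dilation by K pushes the measure forward, and a constant density restores the
  total mass.\<close>

lemma ex_spectral_measure: "\<exists>m. spectral_measure_of T K \<psi> m"
proof -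
  define S where "S x = (1 / K) *\<^sub>R T x" for x
  interpret S: symmetric_operator S
  proof (rule symmetric_operator.intro)
    show "bounded_linear S"
      unfolding S_def by (rule bounded_linear_const_scaleR[OF bounded_linear])
  qed (simp add: S_def sym)
  have S_pow: "(S ^^ n) x = (1 / K) ^ n *\<^sub>R (T ^^ n) x" for n x
    by (induction n) (auto simp: S_def scaleR)
  have poly_op_X: "poly_op S [:0, 1:] = S"
    by (simp add: fun_eq_iff S.zero)
  have "\<exists>M. real_distribution M \<and> (AE x in M. 0 \<le> x \<and> x \<le> 1) \<and>
      (\<forall>n. inner ((S ^^ n) \<psi>) \<psi> = (norm \<psi>)\<^sup>2 * (\<integral>x. x ^ n \<partial>M))"
  proof (cases "\<psi> = 0")
    case True
    \<comment> \<open>For the zero vector any distribution on [0, 1] will do, as the factor in front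
      of the integral is 0.\<close>
    have "real_distribution (return borel 0)"
      by (simp add: real_distribution_def real_distribution_axioms_def prob_space_return)
    moreover have "AE x in return borel 0. 0 \<le> x \<and> x \<le> (1::real)"
      by (simp add: AE_return)
    ultimately show ?thesis using True by auto
  next
    case False
    define L where "L p = inner (poly_op S p \<psi>) \<psi> / (norm \<psi>)\<^sup>2" for p
    have "0 \<le> L ([:0, 1:] ^ k * [:1, -1:] ^ l)" for k l
      unfolding L_def using nonneg le K_pos
      by (intro divide_nonneg_nonneg S.bernstein_nonneg) (auto simp: S_def field_simps)
    then obtain M where "real_distribution M" "AE x in M. 0 \<le> x \<and> x \<le> 1"
      and M: "\<And>j. (\<integral>x. x ^ j \<partial>M) = L ([:0, 1:] ^ j)"
      by (rule hausdorff_moment[of L, rotated 2])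
        (use False in \<open>auto simp: L_def S.poly_op_add S.poly_op_smult inner_add_left add_divide_distrib
            power2_norm_eq_inner\<close>)
    moreover have "inner ((S ^^ n) \<psi>) \<psi> = (norm \<psi>)\<^sup>2 * (\<integral>x. x ^ n \<partial>M)" for n
      using False unfolding M by (simp add: L_def S.poly_op_power poly_op_X)
    ultimately show ?thesis by blast
  qed
  then obtain M where "real_distribution M" and supp: "AE x in M. 0 \<le> x \<and> x \<le> 1"
    and M: "\<And>n. inner ((S ^^ n) \<psi>) \<psi> = (norm \<psi>)\<^sup>2 * (\<integral>x. x ^ n \<partial>M)"
    by blast
  interpret M: real_distribution M by fact
  define D where "D = distr M borel (\<lambda>x. K * x)"
  interpret D: real_distribution D
    unfolding D_def by (rule M.real_distribution_distr) auto
  define m where "m = density D (\<lambda>_. ennreal ((norm \<psi>)\<^sup>2))"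
  have "finite_measure m"
    by (rule finite_measureI)
      (auto simp: m_def emeasure_density_const D.emeasure_space_1 ennreal_mult_eq_top_iff)
  moreover have "sets m = sets borel" by (simp add: m_def)
  moreover have "AE x in m. 0 \<le> x \<and> x \<le> K"
  proof -
    have "AE x in D. 0 \<le> x \<and> x \<le> K"
      unfolding D_def by (subst AE_distr_iff) (use supp K_pos in \<open>auto elim!: eventually_mono\<close>)
    then show ?thesis
      unfolding m_def by (subst AE_density) (auto elim!: eventually_mono)
  qed
  moreover have "inner ((T ^^ n) \<psi>) \<psi> = (\<integral>x. x ^ n \<partial>m)" for n
  proof -
    have "inner ((T ^^ n) \<psi>) \<psi> = K ^ n * inner ((S ^^ n) \<psi>) \<psi>"
      using K_pos by (simp add: S_pow power_divide)
    also have "\<dots> = (norm \<psi>)\<^sup>2 * (\<integral>x. (K * x) ^ n \<partial>M)"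
      by (simp add: M power_mult_distrib)
    also have "(\<integral>x. (K * x) ^ n \<partial>M) = (\<integral>x. x ^ n \<partial>D)"
      unfolding D_def by (subst integral_distr) auto
    also have "(norm \<psi>)\<^sup>2 * \<dots> = (\<integral>x. x ^ n \<partial>m)"
      unfolding m_def by (subst integral_density) auto
    finally show ?thesis .
  qed
  ultimately show ?thesis unfolding spectral_measure_of_def by blast
qed

context
  fixes \<psi> :: 'h and m :: "real measure"
  assumes spectral: "spectral_measure_of T K \<psi> m"
begin

lemma
  shows spectral_finite: "finite_measure m" and spectral_sets: "sets m = sets borel"
    and spectral_support: "AE x in m. \<bar>x\<bar> \<le> K"
    and spectral_moments: "\<And>n. inner ((T ^^ n) \<psi>) \<psi> = (\<integral>x. x ^ n \<partial>m)"
proof -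
  from spectral have *: "AE x in m. 0 \<le> x \<and> x \<le> K" by (simp only: spectral_measure_of_def)
  then show "AE x in m. \<bar>x\<bar> \<le> K" by eventually_elim auto
qed (use spectral in \<open>auto simp: spectral_measure_of_def\<close>)

lemmas spectral_basic = spectral_finite spectral_sets spectral_support

lemma inner_poly_op: "inner (poly_op T p \<psi>) \<psi> = (\<integral>x. poly p x \<partial>m)"
proof -
  \<comment> \<open>The extra power of T makes the induction go through: the Horner step for
    \<open>pCons\<close> moves one application of T from the polynomial into the power.\<close>
  have "inner ((T ^^ n) (poly_op T p \<psi>)) \<psi> = (\<integral>x. poly (monom 1 n * p) x \<partial>m)" for n
  proof (induction p arbitrary: n)
    case 0
    have "(T ^^ n) 0 = 0" by (induction n) (auto simp: zero)
    then show ?case by simp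
  next
    case (pCons a p)
    have lin: "(T ^^ n) (x + y) = (T ^^ n) x + (T ^^ n) y" "(T ^^ n) (c *\<^sub>R x) = c *\<^sub>R (T ^^ n) x" for x y c
      by (induction n) (auto simp: add scaleR)
    have "inner ((T ^^ n) (poly_op T (pCons a p) \<psi>)) \<psi>
        = a * inner ((T ^^ n) \<psi>) \<psi> + inner ((T ^^ Suc n) (poly_op T p \<psi>)) \<psi>"
      by (simp add: lin inner_add_left funpow_swap1)
    also have "\<dots> = (\<integral>x. poly (smult a (monom 1 n)) x \<partial>m) + (\<integral>x. poly (monom 1 (Suc n) * p) x \<partial>m)"
      unfolding pCons spectral_moments by (simp add: fun_poly_mult poly_monom)
    also have "\<dots> = (\<integral>x. poly (smult a (monom 1 n)) x + poly (monom 1 (Suc n) * p) x \<partial>m)"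
      by (rule Bochner_Integration.integral_add[symmetric]) (rule integrable_poly_measure[OF spectral_basic])+
    also have "(\<lambda>x. poly (smult a (monom 1 n)) x + poly (monom 1 (Suc n) * p) x)
        = poly (monom 1 n * pCons a p)"
      by (simp add: fun_eq_iff poly_monom algebra_simps)
    finally show ?case .
  qed
  from this[of 0] show ?thesis by (simp flip: one_pCons)
qed

lemma norm_poly_op_integral: "(norm (poly_op T p \<psi>))\<^sup>2 = (\<integral>x. (poly p x)\<^sup>2 \<partial>m)"
  unfolding norm_poly_op inner_poly_op by (simp add: fun_poly_mult power2_eq_square)

lemma norm_poly_op_le:
  assumes "\<And>x. \<bar>x\<bar> \<le> K \<Longrightarrow> \<bar>poly p x\<bar> \<le> B" and "0 \<le> B"
  shows "norm (poly_op T p \<psi>) \<le> B * norm \<psi>"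
proof -
  \<comment> \<open>The constant is written with \<open>poly 1\<close> so that
    \<open>inner_poly_op\<close> evaluates its integral to the squared norm of the vector.\<close>
  have "(norm (poly_op T p \<psi>))\<^sup>2 \<le> (\<integral>x. B\<^sup>2 * poly 1 x \<partial>m)"
    unfolding norm_poly_op_integral
  proof (rule integral_mono_AE)
    show "integrable m (\<lambda>x. (poly p x)\<^sup>2)"
      using integrable_poly_measure[OF spectral_basic, of "p ^ 2"] by (simp add: poly_power[abs_def])
    show "integrable m (\<lambda>x. B\<^sup>2 * poly 1 x)"
      by (intro integrable_mult_right integrable_poly_measure[OF spectral_basic])
    show "AE x in m. (poly p x)\<^sup>2 \<le> B\<^sup>2 * poly 1 x"
      using spectral_support by eventually_elim (use assms in \<open>auto intro: abs_le_square_iff[THEN iffD1]\<close>)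
  qed
  also have "\<dots> = B\<^sup>2 * (norm \<psi>)\<^sup>2"
    using inner_poly_op[of 1] by (simp add: power2_norm_eq_inner)
  finally show ?thesis
    using assms(2) by (metis abs_le_square_iff abs_mult abs_norm_cancel abs_of_nonneg power_mult_distrib)
qed

text \<open>The map from polynomials p to \<open>poly_op T p \<psi>\<close> is isometric for the L2
  norm of m, and the polynomials converge to the indicator in that norm by dominated
  convergence.\<close>

lemma Cauchy_poly_op:
  assumes p: "\<And>n x. \<bar>x\<bar> \<le> K \<Longrightarrow> \<bar>poly (p n) x\<bar> \<le> 2"
    "\<And>x. \<bar>x\<bar> \<le> K \<Longrightarrow> (\<lambda>n. poly (p n) x) \<longlonglongrightarrow> indicator {..s} x"
  shows "Cauchy (\<lambda>n. poly_op T (p n) \<psi>)"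
proof -
  interpret finite_measure m by (rule spectral_finite)
  let ?e = "\<lambda>n x. (poly (p n) x - indicator {..s} x)\<^sup>2"
  have [measurable]: "(\<lambda>x. indicator {..s} x :: real) \<in> borel_measurable m"
    by (rule borel_measurable_indicator) (simp add: spectral_sets)
  have [measurable]: "poly q \<in> borel_measurable m" for q
    by (rule borel_measurable_poly_measure[OF spectral_basic])
  \<comment> \<open>The bound is 9 = (2 + 1)^2: the polynomials are bounded by 2 and the indicator
    by 1.\<close>
  have e_le: "AE x in m. norm (?e n x) \<le> 9" for n
  proof -
    have "(poly (p n) x - indicator {..s} x)\<^sup>2 \<le> 3\<^sup>2" if "\<bar>x\<bar> \<le> K" for x
      by (rule abs_le_square_iff[THEN iffD1]) (use p(1)[OF that, of n] in \<open>auto simp: indicator_def\<close>)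
    then show ?thesis using spectral_support by (auto elim!: eventually_mono)
  qed
  have int_e: "integrable m (?e n)" for n
    by (rule integrable_const_bound[OF e_le]) measurable
  have "(\<lambda>n. \<integral>x. ?e n x \<partial>m) \<longlonglongrightarrow> (\<integral>x. 0 \<partial>m)"
  proof (rule integral_dominated_convergence[OF _ _ _ _ e_le])
    show "AE x in m. (\<lambda>n. ?e n x) \<longlonglongrightarrow> 0"
      using spectral_support
    proof eventually_elim
      case (elim x)
      from p(2)[OF this] have "(\<lambda>n. poly (p n) x - indicator {..s} x) \<longlonglongrightarrow> 0"
        by (rule LIM_zero)
      from tendsto_power[OF this, of 2] show ?case by simp
    qed
  qed auto
  then have lim: "(\<lambda>n. \<integral>x. ?e n x \<partial>m) \<longlonglongrightarrow> 0" by simp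
  have dist: "(norm (poly_op T (p i) \<psi> - poly_op T (p j) \<psi>))\<^sup>2
      \<le> 2 * (\<integral>x. ?e i x \<partial>m) + 2 * (\<integral>x. ?e j x \<partial>m)" for i j
  proof -
    have "(norm (poly_op T (p i) \<psi> - poly_op T (p j) \<psi>))\<^sup>2 = (\<integral>x. (poly (p i - p j) x)\<^sup>2 \<partial>m)"
      by (simp only: poly_op_diff[symmetric] norm_poly_op_integral)
    also have "\<dots> \<le> (\<integral>x. 2 * ?e i x + 2 * ?e j x \<partial>m)"
    proof (rule integral_mono)
      show "integrable m (\<lambda>x. (poly (p i - p j) x)\<^sup>2)"
        using integrable_poly_measure[OF spectral_basic, of "(p i - p j) ^ 2"] by (simp add: poly_power[abs_def])
      fix x
      have "(a - b)\<^sup>2 \<le> 2 * (a - c)\<^sup>2 + 2 * (b - c)\<^sup>2" for a b c :: real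
        using zero_le_power2[of "(a - c) + (b - c)"] by (simp add: power2_eq_square algebra_simps)
      then show "(poly (p i - p j) x)\<^sup>2 \<le> 2 * ?e i x + 2 * ?e j x" by simp
    qed (use int_e in auto)
    also have "\<dots> = 2 * (\<integral>x. ?e i x \<partial>m) + 2 * (\<integral>x. ?e j x \<partial>m)"
      using int_e by simp
    finally show ?thesis .
  qed
  show ?thesis
  proof (rule CauchyI)
    fix \<epsilon> :: real assume "0 < \<epsilon>"
    \<comment> \<open>Each of the two integrals enters \<open>dist\<close> with factor 2, so a
      quarter of the squared tolerance suffices.\<close>
    then have "eventually (\<lambda>n. (\<integral>x. ?e n x \<partial>m) < \<epsilon>\<^sup>2 / 4) sequentially"
      by (intro order_tendstoD(2)[OF lim]) auto
    then obtain N where N: "\<And>n. n \<ge> N \<Longrightarrow> (\<integral>x. ?e n x \<partial>m) < \<epsilon>\<^sup>2 / 4"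
      by (auto simp: eventually_sequentially)
    have "norm (poly_op T (p i) \<psi> - poly_op T (p j) \<psi>) < \<epsilon>" if "i \<ge> N" "j \<ge> N" for i j
    proof -
      have "(norm (poly_op T (p i) \<psi> - poly_op T (p j) \<psi>))\<^sup>2 < \<epsilon>\<^sup>2"
        using dist[of i j] N[OF that(1)] N[OF that(2)] by linarith
      then show ?thesis using \<open>0 < \<epsilon>\<close> by (simp add: power2_less_imp_less)
    qed
    then show "\<exists>N. \<forall>i\<ge>N. \<forall>j\<ge>N. norm (poly_op T (p i) \<psi> - poly_op T (p j) \<psi>) < \<epsilon>" by blast
  qed
qed

end

text \<open>One polynomial sequence serves all vectors, since all spectral measures live on [0, K];
  this makes the strong limit linear. The commutation property is what later yields complex
  linearity and invariance of the functions supported in the carrier.\<close>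

theorem ex_spectral_projection:
  obtains P where "bounded_linear P" "\<And>x y. inner (P x) y = inner x (P y)"
    "\<And>A x. bounded_linear A \<Longrightarrow> (\<And>y. A (T y) = T (A y)) \<Longrightarrow> A (P x) = P (A x)"
    "\<And>\<psi> m. spectral_measure_of T K \<psi> m \<Longrightarrow> inner (P \<psi>) \<psi> = measure m {..s}"
proof -
  obtain p :: "nat \<Rightarrow> real poly" where p: "\<And>n x. \<bar>x\<bar> \<le> K \<Longrightarrow> \<bar>poly (p n) x\<bar> \<le> 2"
    "\<And>x. \<bar>x\<bar> \<le> K \<Longrightarrow> (\<lambda>n. poly (p n) x) \<longlonglongrightarrow> indicator {..s} x"
    by (rule polys_tendsto_indicator_atMost[of K s]) blast
  define P where "P x = lim (\<lambda>n. poly_op T (p n) x)" for x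
  have lim: "(\<lambda>n. poly_op T (p n) x) \<longlonglongrightarrow> P x" for x
  proof -
    obtain m where "spectral_measure_of T K x m" using ex_spectral_measure by blast
    from Cauchy_poly_op[OF this p] show ?thesis
      unfolding P_def by (simp add: Cauchy_convergent convergent_LIMSEQ_iff[symmetric])
  qed
  show ?thesis
  proof
    show "bounded_linear P"
    proof
      fix x y and r :: real
      interpret pn: bounded_linear "poly_op T (p n)" for n by (rule bounded_linear_poly_op)
      show "P (x + y) = P x + P y"
        using lim[of "x + y"] tendsto_add[OF lim[of x] lim[of y]]
        by (simp add: pn.add LIMSEQ_unique)
      show "P (r *\<^sub>R x) = r *\<^sub>R P x"
        using lim[of "r *\<^sub>R x"] tendsto_scaleR[OF tendsto_const lim[of x], of r]
        by (simp add: pn.scaleR LIMSEQ_unique)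
      show "\<exists>C. \<forall>x. norm (P x) \<le> norm x * C"
      proof (intro exI allI)
        fix x
        obtain m where m: "spectral_measure_of T K x m" using ex_spectral_measure by blast
        show "norm (P x) \<le> norm x * 2"
          by (rule tendsto_upperbound[OF tendsto_norm[OF lim]])
            (use norm_poly_op_le[OF m p(1)] in \<open>auto simp: mult.commute\<close>)
      qed
    qed
    show "inner (P x) y = inner x (P y)" for x y
      using tendsto_inner[OF lim[of x] tendsto_const[of y]] tendsto_inner[OF tendsto_const[of x] lim[of y]]
      by (simp add: poly_op_sym LIMSEQ_unique)
    show "A (P x) = P (A x)" if "bounded_linear A" "\<And>y. A (T y) = T (A y)" for A x
    proof -
      have "(\<lambda>n. A (poly_op T (p n) x)) \<longlonglongrightarrow> A (P x)"
        by (rule bounded_linear.tendsto[OF that(1) lim])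
      moreover have "A (poly_op T (p n) x) = poly_op T (p n) (A x)" for n
        using that by (intro poly_op_commute bounded_linear.linear)
      ultimately show ?thesis using lim[of "A x"] by (simp add: LIMSEQ_unique)
    qed
    show "inner (P \<psi>) \<psi> = measure m {..s}" if m: "spectral_measure_of T K \<psi> m" for \<psi> m
    proof -
      have "(\<lambda>n. inner (poly_op T (p n) \<psi>) \<psi>) \<longlonglongrightarrow> inner (P \<psi>) \<psi>"
        by (rule tendsto_inner[OF lim tendsto_const])
      moreover have "(\<lambda>n. inner (poly_op T (p n) \<psi>) \<psi>) \<longlonglongrightarrow> measure m {..s}"
        unfolding inner_poly_op[OF m]
        by (rule integral_polys_tendsto_measure_atMost[OF spectral_basic[OF m] p])
      ultimately show ?thesis by (rule LIMSEQ_unique)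
    qed
  qed
qed

end

section \<open>The Hilbert space of square-summable functions on a type\<close>

lemma square_summable_inner_summable:
  fixes f g :: "'a \<Rightarrow> complex"
  assumes f: "(\<lambda>x. (norm (f x))\<^sup>2) summable_on A" and g: "(\<lambda>x. (norm (g x))\<^sup>2) summable_on A"
  shows "(\<lambda>x. f x * cnj (g x)) summable_on A" "(\<lambda>x. inner (f x) (g x)) summable_on A"
    "(\<lambda>x. (norm (f x + g x))\<^sup>2) summable_on A"
proof -
  have sum: "(\<lambda>x. (norm (f x))\<^sup>2 + (norm (g x))\<^sup>2) summable_on A"
    using f g by (rule summable_on_add)
  have am_gm: "norm (f x) * norm (g x) \<le> (norm (f x))\<^sup>2 + (norm (g x))\<^sup>2" for x
  proof -
    have "0 \<le> norm (f x) * norm (g x)" by simp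
    then show ?thesis using sum_squares_bound[of "norm (f x)" "norm (g x)"] by linarith
  qed
  have "(\<lambda>x. norm (f x * cnj (g x))) summable_on A"
    by (rule Infinite_Sum.abs_summable_on_comparison_test'[OF sum]) (use am_gm in \<open>simp add: norm_mult\<close>)
  then show "(\<lambda>x. f x * cnj (g x)) summable_on A"
    by (rule abs_summable_summable)
  then show "(\<lambda>x. inner (f x) (g x)) summable_on A"
    using summable_on_Re[of "\<lambda>x. f x * cnj (g x)" A] by (simp add: inner_complex_def)
  have "(\<lambda>x. norm ((norm (f x + g x))\<^sup>2)) summable_on A"
  proof (rule Infinite_Sum.abs_summable_on_comparison_test'[OF summable_on_cmult_right[OF sum, of 2]])
    fix x
    have "(norm (f x + g x))\<^sup>2 \<le> (norm (f x) + norm (g x))\<^sup>2"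
      by (simp add: norm_triangle_ineq power_mono)
    also have "\<dots> \<le> 2 * ((norm (f x))\<^sup>2 + (norm (g x))\<^sup>2)"
      using sum_squares_bound[of "norm (f x)" "norm (g x)"] by (simp add: power2_sum)
    finally show "norm ((norm (f x + g x))\<^sup>2) \<le> 2 * ((norm (f x))\<^sup>2 + (norm (g x))\<^sup>2)" by simp
  qed
  then show "(\<lambda>x. (norm (f x + g x))\<^sup>2) summable_on A" by simp
qed

lemma square_summable_scale:
  fixes f :: "'a \<Rightarrow> complex"
  assumes "(\<lambda>x. (norm (f x))\<^sup>2) summable_on A"
  shows "(\<lambda>x. (norm (c * f x))\<^sup>2) summable_on A"
  using summable_on_cmult_right[OF assms, of "(norm c)\<^sup>2"] by (simp add: norm_mult power_mult_distrib)

text \<open>A type cannot depend on the group, so functions on the whole type are taken and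
  \<open>ell2 G\<close> becomes the subspace of those that vanish off the carrier. Only the real
  inner product, the real part of the complex one, is used as structure; multiplication by the
  imaginary unit returns as the operator \<open>l2_times_i\<close>.\<close>

typedef 'a l2 = "{f :: 'a \<Rightarrow> complex. (\<lambda>x. (norm (f x))\<^sup>2) summable_on UNIV}"
  morphisms l2_fun Abs_l2
  by (rule exI[of _ "\<lambda>_. 0"]) simp

lemma l2_fun_summable: "(\<lambda>x. (norm (l2_fun F x))\<^sup>2) summable_on UNIV"
  using l2_fun[of F] by simp

lemma l2_eqI: "(\<And>x. l2_fun F x = l2_fun H x) \<Longrightarrow> F = H"
  by (simp add: l2_fun_inject[symmetric] fun_eq_iff)

instantiation l2 :: (type) real_inner
begin

definition "0 = Abs_l2 (\<lambda>_. 0)"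
definition "F + H = Abs_l2 (\<lambda>x. l2_fun F x + l2_fun H x)"
definition "- F = Abs_l2 (\<lambda>x. - l2_fun F x)"
definition "F - H = Abs_l2 (\<lambda>x. l2_fun F x - l2_fun H x)"
definition "r *\<^sub>R F = Abs_l2 (\<lambda>x. r *\<^sub>R l2_fun F x)"
definition "inner F H = (\<Sum>\<^sub>\<infinity>x. inner (l2_fun F x) (l2_fun H x))"
definition "norm (F :: 'a l2) = sqrt (inner F F)"
definition "sgn (F :: 'a l2) = scaleR (inverse (norm F)) F"
definition "dist F (H :: 'a l2) = norm (F - H)"
definition "(uniformity :: ('a l2 \<times> 'a l2) filter) = (INF e\<in>{0 <..}. principal {(x, y). dist x y < e})"
definition "open (U :: 'a l2 set) \<longleftrightarrow> (\<forall>x\<in>U. eventually (\<lambda>(x', y). x' = x \<longrightarrow> y \<in> U) uniformity)"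

lemma l2_fun_zero [simp]: "l2_fun 0 x = 0"
  by (simp add: zero_l2_def Abs_l2_inverse)

lemma l2_fun_add [simp]: "l2_fun (F + H) x = l2_fun F x + l2_fun H x"
  using square_summable_inner_summable(3)[OF l2_fun_summable l2_fun_summable, of F H]
  by (simp add: plus_l2_def Abs_l2_inverse)

lemma l2_fun_uminus [simp]: "l2_fun (- F) x = - l2_fun F x"
  using l2_fun_summable[of F] by (simp add: uminus_l2_def Abs_l2_inverse)

lemma l2_fun_diff [simp]: "l2_fun (F - H) x = l2_fun F x - l2_fun H x"
  using square_summable_inner_summable(3)[OF l2_fun_summable l2_fun_summable, of F "- H"]
  by (simp add: minus_l2_def Abs_l2_inverse)

lemma l2_fun_scaleR [simp]: "l2_fun (r *\<^sub>R F) x = r *\<^sub>R l2_fun F x"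
  using square_summable_scale[OF l2_fun_summable, of "of_real r" F]
  by (simp add: scaleR_l2_def Abs_l2_inverse scaleR_conv_of_real)

lemma l2_inner_summable: "(\<lambda>x. inner (l2_fun F x) (l2_fun H x)) summable_on A"
  using square_summable_inner_summable(2)[OF l2_fun_summable l2_fun_summable, of F H]
  by (rule summable_on_subset) auto

instance
proof
  fix F H I :: "'a l2" and r :: real
  show "inner F H = inner H F"
    by (simp add: inner_l2_def inner_commute)
  show "inner (F + H) I = inner F I + inner H I"
    using infsum_add[OF l2_inner_summable l2_inner_summable] by (simp add: inner_l2_def inner_add_left)
  show "inner (r *\<^sub>R F) H = r * inner F H"
    by (simp add: inner_l2_def infsum_cmult_right')
  show "0 \<le> inner F F"
    by (simp add: inner_l2_def infsum_nonneg)
  show "(inner F F = 0) = (F = 0)"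
  proof
    assume "inner F F = 0"
    then have "inner (l2_fun F x) (l2_fun F x) = 0" for x
      unfolding inner_l2_def using nonneg_infsum_le_0D[OF _ l2_inner_summable, of F F UNIV x] by simp
    then show "F = 0" by (auto intro: l2_eqI)
  qed (simp add: inner_l2_def)
qed (auto simp: sgn_l2_def dist_l2_def uniformity_l2_def open_l2_def norm_l2_def
    intro!: l2_eqI simp: algebra_simps scaleR_add_left scaleR_add_right)

end

lemma norm_l2_square: "(norm F)\<^sup>2 = (\<Sum>\<^sub>\<infinity>x. (norm (l2_fun F x))\<^sup>2)"
  by (simp add: power2_norm_eq_inner inner_l2_def)

lemma sum_norm_l2_le: "finite A \<Longrightarrow> (\<Sum>x\<in>A. (norm (l2_fun F x))\<^sup>2) \<le> (norm F)\<^sup>2"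
  unfolding norm_l2_square by (rule finite_sum_le_infsum[OF l2_fun_summable]) auto

lemma norm_l2_fun_le: "norm (l2_fun F x) \<le> norm F"
  using sum_norm_l2_le[of "{x}" F] by (simp add: power2_le_iff_abs_le)

lemma norm_l2_leI:
  assumes "\<And>A. finite A \<Longrightarrow> (\<Sum>x\<in>A. (norm (l2_fun F x))\<^sup>2) \<le> B\<^sup>2" "0 \<le> B"
  shows "norm F \<le> B"
proof -
  have "(norm F)\<^sup>2 \<le> B\<^sup>2"
    unfolding norm_l2_square by (rule infsum_le_finite_sums[OF l2_fun_summable]) (use assms in auto)
  then show ?thesis using assms(2) by (simp add: power2_le_iff_abs_le)
qed

lemma bounded_linear_l2_fun: "bounded_linear (\<lambda>F. l2_fun F x)"
  by (rule bounded_linear_intro[of _ 1]) (use norm_l2_fun_le in auto)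

text \<open>The candidate limit is the pointwise one. Cauchy estimates on finite sums pass to it,
  which shows first that it is square summable, as a sum of two square summable functions, and then
  that convergence holds in norm.\<close>

instance l2 :: (type) complete_space
proof
  fix X :: "nat \<Rightarrow> 'a l2"
  assume X: "Cauchy X"
  have "convergent (\<lambda>n. l2_fun (X n) x)" for x
    using bounded_linear.Cauchy[OF bounded_linear_l2_fun X] by (simp add: Cauchy_convergent)
  then obtain g where g: "\<And>x. (\<lambda>n. l2_fun (X n) x) \<longlonglongrightarrow> g x"
    unfolding convergent_def by metis
  \<comment> \<open>The estimate is stated for finite sums because the limit is not yet known to lie
    in the space.\<close>
  have tail: "\<exists>N. \<forall>n\<ge>N. \<forall>A. finite A \<longrightarrow> (\<Sum>x\<in>A. (norm (l2_fun (X n) x - g x))\<^sup>2) \<le> e\<^sup>2"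
    if "e > 0" for e
  proof -
    obtain N where N: "\<And>i j. i \<ge> N \<Longrightarrow> j \<ge> N \<Longrightarrow> norm (X i - X j) < e"
      using CauchyD[OF X \<open>e > 0\<close>] by blast
    have "(\<Sum>x\<in>A. (norm (l2_fun (X n) x - g x))\<^sup>2) \<le> e\<^sup>2" if "n \<ge> N" "finite A" for n A
    proof (rule tendsto_upperbound)
      show "(\<lambda>k. \<Sum>x\<in>A. (norm (l2_fun (X n) x - l2_fun (X k) x))\<^sup>2)
          \<longlonglongrightarrow> (\<Sum>x\<in>A. (norm (l2_fun (X n) x - g x))\<^sup>2)"
        by (intro tendsto_intros g)
      show "\<forall>\<^sub>F k in sequentially. (\<Sum>x\<in>A. (norm (l2_fun (X n) x - l2_fun (X k) x))\<^sup>2) \<le> e\<^sup>2"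
      proof (rule eventually_sequentiallyI[of N])
        fix k assume "k \<ge> N"
        have "(\<Sum>x\<in>A. (norm (l2_fun (X n) x - l2_fun (X k) x))\<^sup>2) \<le> (norm (X n - X k))\<^sup>2"
          using sum_norm_l2_le[OF \<open>finite A\<close>, of "X n - X k"] by simp
        also have "\<dots> \<le> e\<^sup>2"
          using N[OF \<open>n \<ge> N\<close> \<open>k \<ge> N\<close>] by (simp add: power_mono)
        finally show "(\<Sum>x\<in>A. (norm (l2_fun (X n) x - l2_fun (X k) x))\<^sup>2) \<le> e\<^sup>2" .
      qed
    qed simp
    then show ?thesis by blast
  qed
  obtain N where N: "\<And>A. finite A \<Longrightarrow> (\<Sum>x\<in>A. (norm (l2_fun (X N) x - g x))\<^sup>2) \<le> 1\<^sup>2"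
    using tail[of 1] by auto
  have "(\<lambda>x. (norm (l2_fun (X N) x - g x))\<^sup>2) summable_on UNIV"
    by (rule nonneg_bdd_above_summable_on) (use N in \<open>auto intro!: bdd_aboveI[of _ "1\<^sup>2"]\<close>)
  then have "(\<lambda>x. (norm (g x - l2_fun (X N) x))\<^sup>2) summable_on UNIV"
    by (simp add: norm_minus_commute)
  from square_summable_inner_summable(3)[OF this l2_fun_summable[of "X N"]]
  have "(\<lambda>x. (norm (g x))\<^sup>2) summable_on UNIV" by simp
  then obtain L where L: "\<And>x. l2_fun L x = g x"
    using Abs_l2_inverse[of g] by (metis mem_Collect_eq)
  have "X \<longlonglongrightarrow> L"
  proof (rule LIMSEQ_I)
    fix r :: real assume "0 < r"
    then obtain N where N: "\<And>n A. n \<ge> N \<Longrightarrow> finite A \<Longrightarrow> (\<Sum>x\<in>A. (norm (l2_fun (X n) x - g x))\<^sup>2) \<le> (r / 2)\<^sup>2"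
      using tail[of "r / 2"] by auto
    have "norm (X n - L) \<le> r / 2" if "n \<ge> N" for n
      by (rule norm_l2_leI) (use N[OF that] L \<open>0 < r\<close> in auto)
    then show "\<exists>no. \<forall>n\<ge>no. norm (X n - L) < r"
      using \<open>0 < r\<close> by (intro exI[of _ N]) force
  qed
  then show "convergent X" by (auto simp: convergent_def)
qed

instance l2 :: (type) banach ..

text \<open>A weighted composition operator cut off outside A. Restriction to a set, multiplication
  by the imaginary unit and translation by a group element are all instances.\<close>

definition l2_wcomp :: "'a set \<Rightarrow> ('a \<Rightarrow> 'a) \<Rightarrow> complex \<Rightarrow> 'a l2 \<Rightarrow> 'a l2" where
  "l2_wcomp A \<sigma> c F = Abs_l2 (\<lambda>x. if x \<in> A then c * l2_fun F (\<sigma> x) else 0)"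

text \<open>Injectivity lets the finite sums for the image be reindexed as finite sums for F without
  repetition.\<close>

lemma
  assumes "inj_on \<sigma> A"
  shows l2_fun_wcomp: "l2_fun (l2_wcomp A \<sigma> c F) x = (if x \<in> A then c * l2_fun F (\<sigma> x) else 0)"
    and norm_l2_wcomp_le: "norm (l2_wcomp A \<sigma> c F) \<le> norm c * norm F"
proof -
  let ?f = "\<lambda>x. if x \<in> A then c * l2_fun F (\<sigma> x) else 0"
  have bd: "(\<Sum>x\<in>B. (norm (?f x))\<^sup>2) \<le> (norm c * norm F)\<^sup>2" if "finite B" for B
  proof -
    have "(\<Sum>x\<in>B. (norm (?f x))\<^sup>2) = (\<Sum>x\<in>B \<inter> A. (norm c)\<^sup>2 * (norm (l2_fun F (\<sigma> x)))\<^sup>2)"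
      using that by (intro sum.mono_neutral_cong_right) (auto simp: norm_mult power_mult_distrib)
    also have "\<dots> = (norm c)\<^sup>2 * (\<Sum>y\<in>\<sigma> ` (B \<inter> A). (norm (l2_fun F y))\<^sup>2)"
      using assms by (subst sum.reindex) (auto simp: sum_distrib_left intro: inj_on_subset)
    also have "\<dots> \<le> (norm c)\<^sup>2 * (norm F)\<^sup>2"
      using that by (intro mult_left_mono sum_norm_l2_le) auto
    finally show ?thesis by (simp add: power_mult_distrib)
  qed
  have "(\<lambda>x. (norm (?f x))\<^sup>2) summable_on UNIV"
    by (rule nonneg_bdd_above_summable_on) (use bd in \<open>auto intro!: bdd_aboveI[of _ "(norm c * norm F)\<^sup>2"]\<close>)
  then have fn: "l2_fun (l2_wcomp A \<sigma> c F) = ?f"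
    by (simp add: l2_wcomp_def Abs_l2_inverse)
  then show "l2_fun (l2_wcomp A \<sigma> c F) x = ?f x" by simp
  show "norm (l2_wcomp A \<sigma> c F) \<le> norm c * norm F"
    by (rule norm_l2_leI) (use bd fn in auto)
qed

lemma bounded_linear_l2_wcomp:
  assumes "inj_on \<sigma> A"
  shows "bounded_linear (l2_wcomp A \<sigma> c)"
proof (rule bounded_linear_intro)
  show "norm (l2_wcomp A \<sigma> c F) \<le> norm F * norm c" for F
    using norm_l2_wcomp_le[OF assms, of c F] by (simp add: mult.commute)
qed (auto intro!: l2_eqI simp: l2_fun_wcomp[OF assms] distrib_left)

section \<open>The spectral theorem for the Laplace operator of a symmetric walk\<close>

abbreviation l2_restrict :: "'a set \<Rightarrow> 'a l2 \<Rightarrow> 'a l2" where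
  "l2_restrict A \<equiv> l2_wcomp A (\<lambda>x. x) 1"

abbreviation l2_times_i :: "'a l2 \<Rightarrow> 'a l2" where
  "l2_times_i \<equiv> l2_wcomp UNIV (\<lambda>x. x) \<i>"

lemma l2_fun_restrict: "l2_fun (l2_restrict A F) x = (if x \<in> A then l2_fun F x else 0)"
  by (simp add: l2_fun_wcomp)

lemma l2_fun_times_i: "l2_fun (l2_times_i F) x = \<i> * l2_fun F x"
  by (simp add: l2_fun_wcomp)

text \<open>With support in A expressed as a fixed point equation, every operator that commutes with
  the restriction preserves it.\<close>

lemma l2_restrict_eq_iff: "l2_restrict A F = F \<longleftrightarrow> (\<forall>x. x \<notin> A \<longrightarrow> l2_fun F x = 0)"
  by (metis l2_eqI l2_fun_restrict)

lemma inner_l2_times_i: "inner (l2_times_i F) H = - inner F (l2_times_i H)"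
proof -
  have "inner (l2_times_i F) H = (\<Sum>\<^sub>\<infinity>x. - inner (l2_fun F x) (l2_fun (l2_times_i H) x))"
    unfolding inner_l2_def by (rule infsum_cong) (simp add: l2_fun_times_i inner_complex_def)
  then show ?thesis by (simp add: infsum_uminus inner_l2_def)
qed

text \<open>
  The imaginary part of the complex quadratic form of an operator \<open>A\<close> is
  \<open>- inner (l2_times_i (A F)) F\<close>.
\<close>

lemma inner_times_i_symmetric_eq_0:
  assumes "\<And>F H. inner (A F) H = inner F (A H)" "\<And>F. l2_times_i (A F) = A (l2_times_i F)"
  shows "inner (l2_times_i (A F)) F = 0"
proof -
  have "inner (l2_times_i (A F)) F = - inner F (A (l2_times_i F))"
    by (simp only: inner_l2_times_i[of "A F"] assms(1))
  also have "\<dots> = - inner (l2_times_i (A F)) F"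
    by (simp only: assms(2) inner_commute)
  finally show ?thesis by simp
qed

section \<open>Passage between \<open>ell2 G\<close> and the type \<open>l2\<close>\<close>

lemma l2_fun_Abs_ell2: "\<psi> \<in> ell2 G \<Longrightarrow> l2_fun (Abs_l2 \<psi>) = \<psi>"
proof -
  assume \<psi>: "\<psi> \<in> ell2 G"
  have "(\<lambda>x. (norm (\<psi> x))\<^sup>2) summable_on carrier G \<longleftrightarrow> (\<lambda>x. (norm (\<psi> x))\<^sup>2) summable_on UNIV"
    by (rule summable_on_cong_neutral) (use \<psi> in \<open>auto simp: ell2_def\<close>)
  then show ?thesis using \<psi> by (intro Abs_l2_inverse) (simp add: ell2_def)
qed

lemma l2_restrict_Abs_ell2: "\<psi> \<in> ell2 G \<Longrightarrow> l2_restrict (carrier G) (Abs_l2 \<psi>) = Abs_l2 \<psi>"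
  unfolding l2_restrict_eq_iff by (simp add: l2_fun_Abs_ell2) (simp add: ell2_def)

context
  fixes G :: "('a, 'b) monoid_scheme" and F :: "'a l2"
  assumes F: "l2_restrict (carrier G) F = F"
begin

lemma l2_fun_outside: "x \<notin> carrier G \<Longrightarrow> l2_fun F x = 0"
  using F by (simp add: l2_restrict_eq_iff)

lemma l2_fun_in_ell2: "l2_fun F \<in> ell2 G"
  using l2_fun_outside summable_on_subset[OF l2_fun_summable, of "carrier G"] by (auto simp: ell2_def)

lemma ell2_norm_l2_fun: "ell2_norm G (l2_fun F) = norm F"
proof -
  have "(\<Sum>\<^sub>\<infinity>x\<in>carrier G. (norm (l2_fun F x))\<^sup>2) = (norm F)\<^sup>2"
    unfolding norm_l2_square by (rule infsum_cong_neutral) (auto simp: l2_fun_outside)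
  then show ?thesis by (simp add: ell2_norm_def)
qed

text \<open>The imaginary part is read off from Im z = - Re (i z).\<close>

lemma ell2_inner_l2_fun:
  "ell2_inner G (l2_fun F) (l2_fun H) = Complex (inner F H) (- inner (l2_times_i F) H)"
proof -
  let ?f = "\<lambda>x. l2_fun F x * cnj (l2_fun H x)"
  have summ: "?f summable_on UNIV"
    by (rule square_summable_inner_summable(1)) (rule l2_fun_summable)+
  have "ell2_inner G (l2_fun F) (l2_fun H) = infsum ?f UNIV"
    unfolding ell2_inner_def by (rule infsum_cong_neutral) (auto simp: l2_fun_outside)
  moreover have "Re (infsum ?f UNIV) = inner F H"
    unfolding infsum_Re[OF summ, symmetric] inner_l2_def by (simp add: inner_complex_def)
  moreover have "Im (infsum ?f UNIV) = - inner (l2_times_i F) H"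
    unfolding infsum_Im[OF summ, symmetric] inner_l2_def infsum_uminus[symmetric]
    by (simp add: inner_complex_def l2_fun_times_i)
  ultimately show ?thesis by (simp add: complex_eq_iff)
qed

end

lemma ell2_add: "f \<in> ell2 G \<Longrightarrow> g \<in> ell2 G \<Longrightarrow> (\<lambda>x. f x + g x) \<in> ell2 G"
  by (simp add: ell2_def square_summable_inner_summable(3))

lemma ell2_scale: "f \<in> ell2 G \<Longrightarrow> (\<lambda>x. c * f x) \<in> ell2 G"
  by (auto simp: ell2_def intro!: square_summable_scale)

lemma ell2_delta_in_ell2: "a \<in> carrier G \<Longrightarrow> ell2_delta a \<in> ell2 G"
  by (auto simp: ell2_def ell2_delta_def intro!: finite_nonzero_values_imp_summable_on
      intro: finite_subset[of _ "{a}"])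

lemma ell2_inner_delta:
  assumes "a \<in> carrier G"
  shows "ell2_inner G f (ell2_delta a) = f a"
proof -
  have "ell2_inner G f (ell2_delta a) = (\<Sum>\<^sub>\<infinity>x\<in>{a}. f x * cnj (ell2_delta a x))"
    unfolding ell2_inner_def by (rule infsum_cong_neutral) (use assms in \<open>auto simp: ell2_delta_def\<close>)
  then show ?thesis by (simp add: ell2_delta_def)
qed

lemma ell2_inner_add_scale:
  assumes "f \<in> ell2 G" "g \<in> ell2 G" "h \<in> ell2 G"
  shows "ell2_inner G (\<lambda>x. f x + c * g x) h = ell2_inner G f h + c * ell2_inner G g h"
    "ell2_inner G h (\<lambda>x. f x + c * g x) = ell2_inner G h f + cnj c * ell2_inner G h g"
proof -
  have s: "(\<lambda>x. u x * cnj (v x)) summable_on carrier G" if "u \<in> ell2 G" "v \<in> ell2 G" for u v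
    using that by (intro square_summable_inner_summable(1)) (auto simp: ell2_def)
  show "ell2_inner G (\<lambda>x. f x + c * g x) h = ell2_inner G f h + c * ell2_inner G g h"
    unfolding ell2_inner_def infsum_cmult_right'[symmetric]
    by (subst infsum_add[symmetric]) (auto intro!: s summable_on_cmult_right assms simp: algebra_simps)
  show "ell2_inner G h (\<lambda>x. f x + c * g x) = ell2_inner G h f + cnj c * ell2_inner G h g"
    unfolding ell2_inner_def infsum_cmult_right'[symmetric]
    by (subst infsum_add[symmetric]) (auto intro!: s summable_on_cmult_right assms simp: algebra_simps)
qed

text \<open>Polarization: the quadratic form at \<open>\<psi> + c * \<delta>\<close>, with
  \<open>\<delta>\<close> the unit mass at x, contains \<open>P \<psi> x\<close> as a coefficient.
  This gives the uniqueness required by \<open>borel_calculus\<close>.\<close>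

lemma bounded_operator_eqI:
  assumes P: "bounded_operator G P" "P \<in> extensional (ell2 G)"
    and Q: "bounded_operator G Q" "Q \<in> extensional (ell2 G)"
    and eq: "\<And>\<psi>. \<psi> \<in> ell2 G \<Longrightarrow> ell2_inner G (P \<psi>) \<psi> = ell2_inner G (Q \<psi>) \<psi>"
  shows "P = Q"
proof (rule extensionalityI[OF P(2) Q(2)], rule ext)
  fix \<psi> x assume \<psi>: "\<psi> \<in> ell2 G"
  show "P \<psi> x = Q \<psi> x"
  proof (cases "x \<in> carrier G")
    case False
    have "P \<psi> \<in> ell2 G" "Q \<psi> \<in> ell2 G"
      using P(1) Q(1) \<psi> by (auto simp: bounded_operator_def)
    then show ?thesis using False by (simp add: ell2_def)
  next
    case True
    define \<delta> where "\<delta> = ell2_delta x"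
    have \<delta>: "\<delta> \<in> ell2 G" unfolding \<delta>_def using True by (rule ell2_delta_in_ell2)
    have expand: "ell2_inner G (A (\<lambda>y. \<psi> y + c * \<delta> y)) (\<lambda>y. \<psi> y + c * \<delta> y)
        = ell2_inner G (A \<psi>) \<psi> + cnj c * A \<psi> x + c * (ell2_inner G (A \<delta>) \<psi> + cnj c * ell2_inner G (A \<delta>) \<delta>)"
      if A: "bounded_operator G A" for A c
    proof -
      have A\<psi>: "A \<psi> \<in> ell2 G" and A\<delta>: "A \<delta> \<in> ell2 G"
        using A \<psi> \<delta> by (auto simp: bounded_operator_def)
      have "A (\<lambda>y. \<psi> y + c * \<delta> y) = (\<lambda>y. A \<psi> y + c * A \<delta> y)"
        using A \<psi> \<delta> ell2_scale[OF \<delta>, of c] by (simp add: bounded_operator_def)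
      then show ?thesis
        using True by (simp add: ell2_inner_add_scale \<psi> \<delta> A\<psi> A\<delta> ell2_add ell2_scale)
          (simp add: \<delta>_def ell2_inner_delta)
    qed
    have "cnj c * P \<psi> x + c * ell2_inner G (P \<delta>) \<psi> = cnj c * Q \<psi> x + c * ell2_inner G (Q \<delta>) \<psi>" for c
      using eq[OF ell2_add[OF \<psi> ell2_scale[OF \<delta>, of c]]] eq[OF \<psi>] eq[OF \<delta>]
      unfolding expand[OF P(1)] expand[OF Q(1)] by (simp add: algebra_simps)
    \<comment> \<open>With a = \<open>P \<psi> x\<close> and b the other coefficient, c = 1
      determines a + b and c = i determines b - a, hence a.\<close>
    from this[of 1] this[of \<i>] show ?thesis
      by (simp add: complex_eq_iff)
  qed
qed

section \<open>The Markov and Laplace operators of a symmetric walk\<close>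

locale symmetric_walk = group G for G :: "('a, 'b) monoid_scheme" (structure) +
  fixes \<mu> :: "'a pmf"
  assumes set_pmf_carrier: "set_pmf \<mu> \<subseteq> carrier G"
    and pmf_inv: "g \<in> carrier G \<Longrightarrow> pmf \<mu> (inv g) = pmf \<mu> g"
begin

definition translate :: "'a \<Rightarrow> 'a l2 \<Rightarrow> 'a l2" where
  "translate g = l2_wcomp (carrier G) (\<lambda>x. x \<otimes> inv g) 1"

lemma inj_translate: "g \<in> carrier G \<Longrightarrow> inj_on (\<lambda>x. x \<otimes> inv g) (carrier G)"
  by (simp add: inj_on_multc)

lemma l2_fun_translate:
  "g \<in> carrier G \<Longrightarrow> l2_fun (translate g F) x = (if x \<in> carrier G then l2_fun F (x \<otimes> inv g) else 0)"
  unfolding translate_def by (subst l2_fun_wcomp[OF inj_translate]) auto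

lemma norm_translate_le: "g \<in> carrier G \<Longrightarrow> norm (translate g F) \<le> norm F"
  unfolding translate_def using norm_l2_wcomp_le[OF inj_translate, of g 1 F] by simp

lemma inner_translate:
  assumes g: "g \<in> carrier G"
  shows "inner (translate g F) H = inner F (translate (inv g) H)"
proof -
  have "inner (translate g F) H = (\<Sum>\<^sub>\<infinity>x\<in>carrier G. inner (l2_fun F (x \<otimes> inv g)) (l2_fun H x))"
    unfolding inner_l2_def by (rule infsum_cong_neutral) (auto simp: l2_fun_translate g)
  also have "\<dots> = (\<Sum>\<^sub>\<infinity>y\<in>carrier G. inner (l2_fun F y) (l2_fun H (y \<otimes> g)))"
    by (rule infsum_reindex_bij_witness[of _ "\<lambda>y. y \<otimes> g" "\<lambda>x. x \<otimes> inv g"])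
      (use g in \<open>auto simp: m_assoc\<close>)
  also have "\<dots> = inner F (translate (inv g) H)"
    unfolding inner_l2_def by (rule infsum_cong_neutral) (auto simp: l2_fun_translate g)
  finally show ?thesis .
qed

text \<open>The sum is taken in the Hilbert space rather than pointwise as in
  \<open>markov_operator\<close>, so that boundedness, symmetry and commutation carry over from the
  translations. \<open>l2_fun_markov\<close> identifies the two.\<close>

definition markov :: "'a l2 \<Rightarrow> 'a l2" where
  "markov F = (\<Sum>\<^sub>\<infinity>g\<in>carrier G. pmf \<mu> g *\<^sub>R translate g F)"

lemma sum_pmf_le_1: "finite A \<Longrightarrow> sum (pmf \<mu>) A \<le> 1"
  by (metis measure_measure_pmf_finite measure_pmf.prob_le_1)

lemma pmf_summable: "pmf \<mu> summable_on A"
  by (rule nonneg_bdd_above_summable_on) (auto intro!: bdd_aboveI[of _ 1] sum_pmf_le_1)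

lemma norm_markov_term_le:
  "g \<in> carrier G \<Longrightarrow> norm (pmf \<mu> g *\<^sub>R translate g F) \<le> pmf \<mu> g * norm F"
  by (simp add: mult_left_mono norm_translate_le)

lemma markov_has_sum: "((\<lambda>g. pmf \<mu> g *\<^sub>R translate g F) has_sum markov F) (carrier G)"
proof -
  have "(\<lambda>g. pmf \<mu> g * norm F) summable_on carrier G"
    by (rule summable_on_cmult_left[OF pmf_summable])
  then have "(\<lambda>g. norm (pmf \<mu> g *\<^sub>R translate g F)) summable_on carrier G"
    by (rule Infinite_Sum.abs_summable_on_comparison_test') (rule norm_markov_term_le)
  then show ?thesis
    unfolding markov_def by (rule has_sum_infsum[OF abs_summable_summable])
qed

lemma norm_markov_le: "norm (markov F) \<le> norm F"
proof -
  have "norm (markov F) \<le> (\<Sum>\<^sub>\<infinity>g\<in>carrier G. pmf \<mu> g * norm F)"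
    by (rule norm_infsum_le[OF markov_has_sum has_sum_infsum])
      (auto intro!: summable_on_cmult_left pmf_summable simp: mult_left_mono norm_translate_le)
  also have "\<dots> = (\<Sum>\<^sub>\<infinity>g\<in>carrier G. pmf \<mu> g) * norm F"
    by (rule infsum_cmult_left')
  also have "(\<Sum>\<^sub>\<infinity>g\<in>carrier G. pmf \<mu> g) \<le> 1"
    by (rule infsum_le_finite_sums[OF pmf_summable]) (rule sum_pmf_le_1)
  finally show ?thesis by (simp add: mult_left_le_one_le mult_right_mono)
qed

lemma bounded_linear_translate: "g \<in> carrier G \<Longrightarrow> bounded_linear (translate g)"
  unfolding translate_def by (rule bounded_linear_l2_wcomp[OF inj_translate])

lemma bounded_linear_markov: "bounded_linear markov"
proof (rule bounded_linear_intro[of _ 1])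
  fix F H :: "'a l2" and r :: real
  have "((\<lambda>g. pmf \<mu> g *\<^sub>R translate g (F + H)) has_sum markov F + markov H) (carrier G)"
    using has_sum_add[OF markov_has_sum[of F] markov_has_sum[of H]]
    by (rule has_sum_cong[THEN iffD1, rotated])
      (simp add: scaleR_add_right linear_add[OF bounded_linear.linear[OF bounded_linear_translate]])
  then show "markov (F + H) = markov F + markov H"
    using has_sum_unique markov_has_sum by blast
  have "((\<lambda>g. pmf \<mu> g *\<^sub>R translate g (r *\<^sub>R F)) has_sum r *\<^sub>R markov F) (carrier G)"
    using has_sum_bounded_linear[OF bounded_linear_scaleR_right markov_has_sum[of F], of r]
    by (rule has_sum_cong[THEN iffD1, rotated])
      (simp add: linear_scale[OF bounded_linear.linear[OF bounded_linear_translate]])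
  then show "markov (r *\<^sub>R F) = r *\<^sub>R markov F"
    using has_sum_unique markov_has_sum by blast
qed (use norm_markov_le in simp)

text \<open>The adjoint of a translation is the translation by the inverse, and the substitution of
  \<open>inv g\<close> for g leaves the weights unchanged.\<close>

lemma markov_sym: "inner (markov F) H = inner F (markov H)"
proof -
  have "((\<lambda>g. pmf \<mu> g * inner (translate g F) H) has_sum inner (markov F) H) (carrier G)"
    using has_sum_bounded_linear[OF bounded_linear_inner_left markov_has_sum[of F], of H] by simp
  moreover have "((\<lambda>g. pmf \<mu> g * inner F (translate g H)) has_sum inner F (markov H)) (carrier G)"
    using has_sum_bounded_linear[OF bounded_linear_inner_right markov_has_sum[of H], of F] by simp
  moreover have "((\<lambda>g. pmf \<mu> g * inner (translate g F) H) has_sum s) (carrier G) \<longleftrightarrow>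
      ((\<lambda>g. pmf \<mu> g * inner F (translate g H)) has_sum s) (carrier G)" for s
    by (rule has_sum_reindex_bij_witness[of _ "m_inv G" "m_inv G"])
      (auto simp: pmf_inv inner_translate)
  ultimately show ?thesis using has_sum_unique by blast
qed

lemma markov_commute:
  assumes "bounded_linear A" "\<And>g F. g \<in> carrier G \<Longrightarrow> A (translate g F) = translate g (A F)"
  shows "A (markov F) = markov (A F)"
proof -
  have "((\<lambda>g. pmf \<mu> g *\<^sub>R translate g (A F)) has_sum A (markov F)) (carrier G)"
    using has_sum_bounded_linear[OF assms(1) markov_has_sum[of F]]
    by (rule has_sum_cong[THEN iffD1, rotated])
      (simp add: assms(2) linear_scale[OF bounded_linear.linear[OF assms(1)]])
  then show ?thesis using has_sum_unique markov_has_sum by blast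
qed

text \<open>Evaluation at a point is a bounded linear map, so it passes through the sum. Off the
  carrier both sides are 0.\<close>

lemma l2_fun_markov: "l2_fun (markov F) = markov_operator G \<mu> (l2_fun F)"
proof
  fix x
  have hs: "((\<lambda>g. pmf \<mu> g *\<^sub>R l2_fun (translate g F) x) has_sum l2_fun (markov F) x) (carrier G)"
    using has_sum_bounded_linear[OF bounded_linear_l2_fun markov_has_sum[of F], of x] by simp
  have "l2_fun (markov F) x = (\<Sum>\<^sub>\<infinity>g\<in>carrier G. pmf \<mu> g *\<^sub>R l2_fun (translate g F) x)"
    by (rule infsumI[OF hs, symmetric])
  also have "\<dots> = markov_operator G \<mu> (l2_fun F) x"
  proof (cases "x \<in> carrier G")
    case True
    then show ?thesis
      by (auto simp: markov_operator_def l2_fun_translate scaleR_conv_of_real mult.commute intro!: infsum_cong)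
  next
    case False
    then show ?thesis
      by (auto simp: markov_operator_def l2_fun_translate intro!: infsum_0)
  qed
  finally show "l2_fun (markov F) x = markov_operator G \<mu> (l2_fun F) x" .
qed

definition laplace :: "'a l2 \<Rightarrow> 'a l2" where
  "laplace F = F - markov F"

lemma l2_fun_laplace_funpow: "l2_fun ((laplace ^^ n) F) = (laplace_operator G \<mu> ^^ n) (l2_fun F)"
proof (induction n)
  case (Suc n)
  have "l2_fun (laplace F) = laplace_operator G \<mu> (l2_fun F)" for F
    by (auto simp: laplace_def laplace_operator_def l2_fun_markov)
  then show ?case using Suc by simp
qed simp

text \<open>The Markov operator is a contraction, so its quadratic form lies between minus and plus
  the squared norm by Cauchy-Schwarz. Hence the form of the Laplace operator lies between 0 and
  twice the squared norm.\<close>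

sublocale laplace: positive_operator laplace 2
proof unfold_locales
  interpret m: bounded_linear markov by (rule bounded_linear_markov)
  have inner_le: "\<bar>inner (markov F) F\<bar> \<le> (norm F)\<^sup>2" for F
    using Cauchy_Schwarz_ineq2[of "markov F" F] mult_right_mono[OF norm_markov_le[of F] norm_ge_zero[of F]]
    by (simp add: power2_eq_square)
  fix F H :: "'a l2" and r :: real
  show "laplace (F + H) = laplace F + laplace H" by (simp add: laplace_def m.add)
  show "laplace (r *\<^sub>R F) = r *\<^sub>R laplace F" by (simp add: laplace_def m.scaleR scaleR_diff_right)
  show "\<exists>C. \<forall>F. norm (laplace F) \<le> norm F * C"
  proof (intro exI allI)
    show "norm (laplace F) \<le> norm F * 2" for F
      unfolding laplace_def using norm_triangle_ineq4[of F "markov F"] norm_markov_le[of F] by simp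
  qed
  show "inner (laplace F) H = inner F (laplace H)"
    by (simp add: laplace_def inner_diff_left inner_diff_right markov_sym)
  show "0 \<le> inner (laplace F) F" "inner (laplace F) F \<le> 2 * (norm F)\<^sup>2"
    using inner_le[of F] by (auto simp: laplace_def inner_diff_left power2_norm_eq_inner)
qed simp

lemma laplace_commute:
  assumes "bounded_linear A" "\<And>g F. g \<in> carrier G \<Longrightarrow> A (translate g F) = translate g (A F)"
  shows "A (laplace F) = laplace (A F)"
  unfolding laplace_def
  by (simp add: markov_commute[OF assms] linear_diff[OF bounded_linear.linear[OF assms(1)]])

lemma bounded_linear_restrict: "bounded_linear (l2_restrict A)"
  and bounded_linear_times_i: "bounded_linear l2_times_i"
  by (rule bounded_linear_l2_wcomp; simp)+

lemma restrict_laplace: "l2_restrict (carrier G) (laplace F) = laplace (l2_restrict (carrier G) F)"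
  by (rule laplace_commute[OF bounded_linear_restrict])
    (auto intro!: l2_eqI simp: l2_fun_restrict l2_fun_translate)

lemma times_i_laplace: "l2_times_i (laplace F) = laplace (l2_times_i F)"
  by (rule laplace_commute[OF bounded_linear_times_i])
    (auto intro!: l2_eqI simp: l2_fun_times_i l2_fun_translate)

text \<open>An operator that is symmetric for the real inner product and commutes with i has a real
  complex quadratic form. This reduces the complex definitions to the real Hilbert space.\<close>

lemma ell2_inner_symmetric:
  assumes sym: "\<And>F H. inner (A F) H = inner F (A H)"
    and "\<And>F. l2_times_i (A F) = A (l2_times_i F)"
    and restr: "\<And>F. l2_restrict (carrier G) (A F) = A (l2_restrict (carrier G) F)"
    and F: "l2_restrict (carrier G) F = F"
  shows "ell2_inner G (l2_fun (A F)) (l2_fun F) = complex_of_real (inner (A F) F)"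
proof -
  have "l2_restrict (carrier G) (A F) = A F" by (simp add: restr F)
  from ell2_inner_l2_fun[OF this] show ?thesis
    using inner_times_i_symmetric_eq_0[of A F] assms by (simp add: complex_eq_iff)
qed

text \<open>The powers of the Laplace operator have real quadratic forms, so the complex moment
  condition becomes the real one. A competitor may have another support bound, which the uniqueness
  theorem allows.\<close>

lemma spectral_measure_at_laplace:
  assumes \<psi>: "\<psi> \<in> ell2 G" and m: "spectral_measure_of laplace 2 (Abs_l2 \<psi>) m"
  shows "spectral_measure_at G (laplace_operator G \<mu>) \<psi> = m"
proof -
  have "ell2_inner G ((laplace_operator G \<mu> ^^ n) \<psi>) \<psi> = complex_of_real (\<integral>x. x ^ n \<partial>m)" for n
  proof -
    have "ell2_inner G (l2_fun ((laplace ^^ n) (Abs_l2 \<psi>))) (l2_fun (Abs_l2 \<psi>))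
        = complex_of_real (inner ((laplace ^^ n) (Abs_l2 \<psi>)) (Abs_l2 \<psi>))"
    proof (rule ell2_inner_symmetric)
      fix F H
      show "inner ((laplace ^^ n) F) H = inner F ((laplace ^^ n) H)"
        by (induction n arbitrary: F H) (auto simp: laplace.sym simp flip: funpow_swap1)
      show "l2_times_i ((laplace ^^ n) F) = (laplace ^^ n) (l2_times_i F)"
        by (induction n) (auto simp: times_i_laplace)
      show "l2_restrict (carrier G) ((laplace ^^ n) F) = (laplace ^^ n) (l2_restrict (carrier G) F)"
        by (induction n) (auto simp: restrict_laplace)
    qed (rule l2_restrict_Abs_ell2[OF \<psi>])
    then show ?thesis
      by (simp add: l2_fun_laplace_funpow l2_fun_Abs_ell2[OF \<psi>] laplace.spectral_moments[OF m])
  qed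
  then have is_m: "is_spectral_measure_at G (laplace_operator G \<mu>) \<psi> m"
    using laplace.spectral_basic[OF m] by (auto simp: is_spectral_measure_at_def)
  show ?thesis
    unfolding spectral_measure_at_def
  proof (rule the_equality, rule is_m)
    fix m' assume m': "is_spectral_measure_at G (laplace_operator G \<mu>) \<psi> m'"
    then obtain K where "AE x in m'. \<bar>x\<bar> \<le> K" "finite_measure m'" "sets m' = sets borel"
      by (auto simp: is_spectral_measure_at_def)
    moreover have "(\<integral>x. x ^ n \<partial>m') = (\<integral>x. x ^ n \<partial>m)" for n
      using m' is_m by (metis is_spectral_measure_at_def of_real_eq_iff)
    ultimately show "m' = m"
      using laplace.spectral_basic[OF m] by (intro compact_support_measure_eqI) auto
  qed
qed

text \<open>The operator P is carried over to \<open>ell2 G\<close>. Commuting with i makes it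
  complex linear, commuting with the restriction keeps it inside \<open>ell2 G\<close>, and the
  quadratic form characterizes it by \<open>bounded_operator_eqI\<close>.\<close>

lemma borel_calculus_laplace:
  assumes P: "bounded_linear P" "\<And>F H. inner (P F) H = inner F (P H)"
    and comm: "\<And>A F. bounded_linear A \<Longrightarrow> (\<And>H. A (laplace H) = laplace (A H)) \<Longrightarrow> A (P F) = P (A F)"
    and quad: "\<And>F m. spectral_measure_of laplace 2 F m \<Longrightarrow> inner (P F) F = measure m {..s}"
  shows "borel_calculus G (laplace_operator G \<mu>) (indicat_real {..s})
    = restrict (\<lambda>\<psi>. l2_fun (P (Abs_l2 \<psi>))) (ell2 G)" (is "_ = ?Q")
proof -
  interpret P: bounded_linear P by fact
  have P_i: "l2_times_i (P F) = P (l2_times_i F)" for F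
    by (rule comm[OF bounded_linear_times_i times_i_laplace])
  have P_restr: "l2_restrict (carrier G) (P F) = P (l2_restrict (carrier G) F)" for F
    by (rule comm[OF bounded_linear_restrict restrict_laplace])
  have P_supp: "l2_restrict (carrier G) (P (Abs_l2 \<psi>)) = P (Abs_l2 \<psi>)" if "\<psi> \<in> ell2 G" for \<psi>
    by (simp add: P_restr l2_restrict_Abs_ell2[OF that])
  have abs_add: "Abs_l2 (\<lambda>x. f x + g x) = Abs_l2 f + Abs_l2 g" if "f \<in> ell2 G" "g \<in> ell2 G" for f g
    by (rule l2_eqI) (simp add: l2_fun_Abs_ell2[where G=G] that ell2_add)
  have abs_scale: "Abs_l2 (\<lambda>x. c * f x) = Re c *\<^sub>R Abs_l2 f + Im c *\<^sub>R l2_times_i (Abs_l2 f)"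
    if "f \<in> ell2 G" for c f
    by (rule l2_eqI) (simp add: l2_fun_Abs_ell2[where G=G] that ell2_scale l2_fun_times_i complex_eq_iff)
  have P_scale: "P (Re c *\<^sub>R F + Im c *\<^sub>R l2_times_i F) = Re c *\<^sub>R P F + Im c *\<^sub>R l2_times_i (P F)" for c F
    by (simp add: P.add P.scaleR P_i)
  have bounded: "bounded_operator G ?Q"
    unfolding bounded_operator_def
  proof (intro conjI ballI allI)
    show "?Q f \<in> ell2 G" if "f \<in> ell2 G" for f
      using l2_fun_in_ell2[OF P_supp[OF that]] that by simp
    show "?Q (\<lambda>x. f x + g x) = (\<lambda>x. ?Q f x + ?Q g x)" if "f \<in> ell2 G" "g \<in> ell2 G" for f g
      using that by (simp add: ell2_add abs_add P.add fun_eq_iff)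
    show "?Q (\<lambda>x. c * f x) = (\<lambda>x. c * ?Q f x)" if "f \<in> ell2 G" for c f
      using that by (simp add: ell2_scale abs_scale P_scale fun_eq_iff l2_fun_times_i complex_eq_iff)
    obtain C where C: "\<And>F. norm (P F) \<le> norm F * C"
      using P.bounded by blast
    show "\<exists>C. \<forall>f\<in>ell2 G. ell2_norm G (?Q f) \<le> C * ell2_norm G f"
    proof (intro exI ballI)
      fix f assume f: "f \<in> ell2 G"
      have "ell2_norm G f = norm (Abs_l2 f)"
        using ell2_norm_l2_fun[OF l2_restrict_Abs_ell2[OF f]] by (simp add: l2_fun_Abs_ell2[OF f])
      then show "ell2_norm G (?Q f) \<le> C * ell2_norm G f"
        using f C[of "Abs_l2 f"] ell2_norm_l2_fun[OF P_supp[OF f]] by (simp add: mult.commute)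
    qed
  qed
  have form: "ell2_inner G (?Q \<psi>) \<psi> =
      complex_of_real (\<integral>x. indicat_real {..s} x \<partial>spectral_measure_at G (laplace_operator G \<mu>) \<psi>)"
    if \<psi>: "\<psi> \<in> ell2 G" for \<psi>
  proof -
    obtain m where m: "spectral_measure_of laplace 2 (Abs_l2 \<psi>) m"
      using laplace.ex_spectral_measure by blast
    have "ell2_inner G (l2_fun (P (Abs_l2 \<psi>))) (l2_fun (Abs_l2 \<psi>)) = complex_of_real (inner (P (Abs_l2 \<psi>)) (Abs_l2 \<psi>))"
      by (rule ell2_inner_symmetric[OF P(2) P_i P_restr l2_restrict_Abs_ell2[OF \<psi>]])
    moreover have "(\<integral>x. indicat_real {..s} x \<partial>m) = measure m {..s}"
      using sets_eq_imp_space_eq[OF laplace.spectral_sets[OF m]] by simp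
    ultimately show ?thesis
      using \<psi> by (simp add: l2_fun_Abs_ell2 spectral_measure_at_laplace[OF \<psi> m] quad[OF m])
  qed
  show ?thesis
    unfolding borel_calculus_def
  proof (rule the_equality)
    show "bounded_operator G ?Q \<and> ?Q \<in> extensional (ell2 G) \<and>
      (\<forall>\<psi>\<in>ell2 G. ell2_inner G (?Q \<psi>) \<psi> =
        complex_of_real (\<integral>x. indicat_real {..s} x \<partial>spectral_measure_at G (laplace_operator G \<mu>) \<psi>))"
      using bounded form by (auto simp del: restrict_apply)
  next
    fix Q
    assume "bounded_operator G Q \<and> Q \<in> extensional (ell2 G) \<and>
      (\<forall>\<psi>\<in>ell2 G. ell2_inner G (Q \<psi>) \<psi> =
        complex_of_real (\<integral>x. indicat_real {..s} x \<partial>spectral_measure_at G (laplace_operator G \<mu>) \<psi>))"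
    then show "Q = ?Q"
      using bounded form by (intro bounded_operator_eqI[of G]) (auto simp del: restrict_apply)
  qed
qed

end

section \<open>Return probabilities and spectral distribution\<close>

context symmetric_walk
begin

definition l2_unit :: "'a l2" where
  "l2_unit = Abs_l2 (ell2_delta \<one>)"

lemma l2_fun_unit: "l2_fun l2_unit = ell2_delta \<one>"
  unfolding l2_unit_def by (rule l2_fun_Abs_ell2[OF ell2_delta_in_ell2[OF one_closed]])

lemma inner_l2_unit: "inner F l2_unit = Re (l2_fun F \<one>)"
proof -
  have "inner F l2_unit = (\<Sum>\<^sub>\<infinity>x\<in>{\<one>}. inner (l2_fun F x) (l2_fun l2_unit x))"
    unfolding inner_l2_def by (rule infsum_cong_neutral) (auto simp: l2_fun_unit ell2_delta_def)
  then show ?thesis by (simp add: l2_fun_unit ell2_delta_def inner_complex_def)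
qed

section \<open>Return probabilities as matrix coefficients of the Markov operator\<close>

lemma set_convolution_power: "set_pmf (convolution_power G \<mu> n) \<subseteq> carrier G"
  by (induction n) (use set_pmf_carrier in \<open>auto simp: convolution_pmf_def\<close>)

lemma pmf_mult_abs_summable:
  assumes h: "\<And>g. \<bar>h g\<bar> \<le> (1::real)"
  shows "(\<lambda>g. norm (pmf \<mu> g * h g)) summable_on A"
  by (rule Infinite_Sum.abs_summable_on_comparison_test'[OF pmf_summable])
    (use h in \<open>simp add: abs_mult mult_left_le\<close>)

lemma expectation_eq_infsum:
  assumes h: "\<And>g. \<bar>h g\<bar> \<le> (1::real)"
  shows "measure_pmf.expectation \<mu> h = (\<Sum>\<^sub>\<infinity>g\<in>carrier G. pmf \<mu> g * h g)"
proof -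
  have "measure_pmf.expectation \<mu> h = (\<Sum>\<^sub>\<infinity>g. pmf \<mu> g * h g)"
    unfolding pmf_expectation_eq_infsetsum
    by (rule infsetsum_infsum, unfold abs_summable_equivalent[symmetric], rule pmf_mult_abs_summable[OF h])
  also have "\<dots> = (\<Sum>\<^sub>\<infinity>g\<in>carrier G. pmf \<mu> g * h g)"
    by (rule infsum_cong_neutral) (use set_pmf_carrier in \<open>auto simp: set_pmf_iff\<close>)
  finally show ?thesis .
qed

lemma pmf_convolution:
  assumes \<nu>: "set_pmf \<nu> \<subseteq> carrier G" and x: "x \<in> carrier G"
  shows "pmf (convolution_pmf G \<nu> \<mu>) x = (\<Sum>\<^sub>\<infinity>g\<in>carrier G. pmf \<mu> g * pmf \<nu> (x \<otimes> inv g))"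
proof -
  \<comment> \<open>Drawing the right factor first gives a mixture over g; the left factor must then
    be \<open>x \<otimes> inv g\<close>, as in the formula for the Markov operator.\<close>
  have "convolution_pmf G \<nu> \<mu> = bind_pmf \<mu> (\<lambda>g. map_pmf (\<lambda>y. y \<otimes> g) \<nu>)"
    unfolding convolution_pmf_def pair_pmf_def map_pmf_def
    by (subst bind_commute_pmf) (simp add: bind_assoc_pmf bind_return_pmf)
  then have "pmf (convolution_pmf G \<nu> \<mu>) x = measure_pmf.expectation \<mu> (\<lambda>g. pmf (map_pmf (\<lambda>y. y \<otimes> g) \<nu>) x)"
    by (simp add: pmf_bind)
  also have "\<dots> = (\<Sum>\<^sub>\<infinity>g\<in>carrier G. pmf \<mu> g * pmf (map_pmf (\<lambda>y. y \<otimes> g) \<nu>) x)"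
    by (rule expectation_eq_infsum) (simp add: pmf_le_1)
  also have "\<dots> = (\<Sum>\<^sub>\<infinity>g\<in>carrier G. pmf \<mu> g * pmf \<nu> (x \<otimes> inv g))"
  proof (rule infsum_cong)
    fix g assume g: "g \<in> carrier G"
    have "pmf (map_pmf (\<lambda>y. y \<otimes> g) \<nu>) x = measure \<nu> ((\<lambda>y. y \<otimes> g) -` {x})"
      by (simp add: pmf_map)
    \<comment> \<open>The two events are only compared almost surely: the equation is solved inside
      the carrier, where \<open>\<nu>\<close> is supported.\<close>
    also have "\<dots> = measure \<nu> {x \<otimes> inv g}"
    proof (rule measure_pmf.finite_measure_eq_AE)
      show "AE y in measure_pmf \<nu>. y \<in> (\<lambda>y. y \<otimes> g) -` {x} \<longleftrightarrow> y \<in> {x \<otimes> inv g}"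
        unfolding AE_measure_pmf_iff using \<nu> x g by (auto simp: inv_solve_right inv_solve_right' m_assoc)
    qed auto
    finally show "pmf \<mu> g * pmf (map_pmf (\<lambda>y. y \<otimes> g) \<nu>) x = pmf \<mu> g * pmf \<nu> (x \<otimes> inv g)"
      by (simp add: measure_pmf_single)
  qed
  finally show ?thesis .
qed

lemma l2_fun_markov_funpow:
  "x \<in> carrier G \<Longrightarrow> l2_fun ((markov ^^ n) l2_unit) x = complex_of_real (pmf (convolution_power G \<mu> n) x)"
proof (induction n arbitrary: x)
  case 0
  then show ?case by (simp add: l2_fun_unit ell2_delta_def)
next
  case (Suc n)
  have "l2_fun ((markov ^^ Suc n) l2_unit) x
      = (\<Sum>\<^sub>\<infinity>g\<in>carrier G. l2_fun ((markov ^^ n) l2_unit) (x \<otimes> inv g) * complex_of_real (pmf \<mu> g))"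
    using Suc.prems by (simp add: l2_fun_markov markov_operator_def)
  also have "\<dots> = (\<Sum>\<^sub>\<infinity>g\<in>carrier G. complex_of_real (pmf \<mu> g * pmf (convolution_power G \<mu> n) (x \<otimes> inv g)))"
    by (rule infsum_cong) (simp add: Suc)
  also have "\<dots> = complex_of_real (\<Sum>\<^sub>\<infinity>g\<in>carrier G. pmf \<mu> g * pmf (convolution_power G \<mu> n) (x \<otimes> inv g))"
    by (rule infsumI, rule has_sum_of_real, rule has_sum_infsum,
        rule abs_summable_summable, rule pmf_mult_abs_summable) (simp add: pmf_le_1)
  also have "\<dots> = complex_of_real (pmf (convolution_power G \<mu> (Suc n)) x)"
    using pmf_convolution[OF set_convolution_power Suc.prems] by simp
  finally show ?case .
qed

lemma return_probability_eq_inner: "return_probability G \<mu> n = inner ((markov ^^ n) l2_unit) l2_unit"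
  by (simp add: inner_l2_unit l2_fun_markov_funpow return_probability_def)

text \<open>By symmetry this is the squared norm of \<open>markov l2_unit\<close>, a vector that
  takes the value of the one-step distribution at every group element and so is not zero.\<close>

lemma return_probability_2_pos: "0 < return_probability G \<mu> 2"
proof -
  obtain x where x: "x \<in> set_pmf (convolution_power G \<mu> 1)"
    by (metis set_pmf_not_empty ex_in_conv)
  then have "l2_fun ((markov ^^ 1) l2_unit) x \<noteq> 0"
    using set_convolution_power[of 1] by (subst l2_fun_markov_funpow) (auto simp: set_pmf_iff)
  then have "markov l2_unit \<noteq> 0" by auto
  moreover have "return_probability G \<mu> 2 = inner (markov l2_unit) (markov l2_unit)"
    by (simp add: return_probability_eq_inner numeral_2_eq_2 markov_sym[of "markov l2_unit"])
  ultimately show ?thesis by simp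
qed

section \<open>The spectral measure at the unit vector\<close>

definition unit_spectral_measure :: "real measure" where
  "unit_spectral_measure = (SOME m. spectral_measure_of laplace 2 l2_unit m)"

lemma unit_spectral_measure: "spectral_measure_of laplace 2 l2_unit unit_spectral_measure"
  unfolding unit_spectral_measure_def by (rule someI_ex[OF laplace.ex_spectral_measure])

lemma return_probability_eq_integral:
  "return_probability G \<mu> n = (\<integral>x. (1 - x) ^ n \<partial>unit_spectral_measure)"
proof -
  have "markov = poly_op laplace [:1, -1:]"
    by (simp add: fun_eq_iff laplace.zero laplace.neg) (simp add: laplace_def)
  then have "return_probability G \<mu> n = inner (poly_op laplace ([:1, -1:] ^ n) l2_unit) l2_unit"
    by (simp add: return_probability_eq_inner laplace.poly_op_power)
  also have "\<dots> = (\<integral>x. poly ([:1, -1:] ^ n) x \<partial>unit_spectral_measure)"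
    by (rule laplace.inner_poly_op[OF unit_spectral_measure])
  also have "poly ([:1, -1:] ^ n) = (\<lambda>x::real. (1 - x) ^ n)"
    by (simp add: fun_eq_iff)
  finally show ?thesis .
qed

lemma spectral_distribution_eq_measure:
  "spectral_distribution G \<mu> s = measure unit_spectral_measure {..s}"
proof -
  obtain P where P: "bounded_linear P" "\<And>x y. inner (P x) y = inner x (P y)"
    "\<And>A x. bounded_linear A \<Longrightarrow> (\<And>y. A (laplace y) = laplace (A y)) \<Longrightarrow> A (P x) = P (A x)"
    "\<And>\<psi> m. spectral_measure_of laplace 2 \<psi> m \<Longrightarrow> inner (P \<psi>) \<psi> = measure m {..s}"
    by (rule laplace.ex_spectral_projection[of s]) blast
  have "borel_calculus G (laplace_operator G \<mu>) (indicat_real {..s})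
      = restrict (\<lambda>\<psi>. l2_fun (P (Abs_l2 \<psi>))) (ell2 G)"
    using P by (rule borel_calculus_laplace)
  then have "spectral_distribution G \<mu> s = Re (l2_fun (P l2_unit) \<one>)"
    by (simp add: spectral_distribution_def ell2_delta_in_ell2 ell2_inner_delta l2_unit_def)
  also have "\<dots> = measure unit_spectral_measure {..s}"
    unfolding inner_l2_unit[symmetric] by (rule P(4)[OF unit_spectral_measure])
  finally show ?thesis .
qed

text \<open>The measure gives no mass to the negative axis, so the extension of the spectral
  distribution by zero is its distribution function, and \<open>interval_measure\<close> recovers
  the measure, including any atom at 0.\<close>

lemma stieltjes_integral_spectral_distribution:
  assumes [measurable]: "h \<in> borel_measurable borel"
  shows "stieltjes_integral (spectral_distribution G \<mu>) h = (\<integral>x. h x \<partial>unit_spectral_measure)"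
proof -
  let ?m = unit_spectral_measure
  let ?F = "\<lambda>x. if 0 \<le> x then spectral_distribution G \<mu> x else 0"
  have sets_m [measurable_cong]: "sets ?m = sets borel"
    by (rule laplace.spectral_sets[OF unit_spectral_measure])
  have supp: "AE x in ?m. 0 \<le> x \<and> x \<le> 2"
    using unit_spectral_measure by (simp only: spectral_measure_of_def)
  interpret m: finite_borel_measure ?m
    using laplace.spectral_finite[OF unit_spectral_measure] sets_m
    by (simp add: finite_borel_measure_def finite_borel_measure_axioms_def)
  have "measure ?m {..x} = 0" if "x < 0" for x
  proof -
    have "AE y in ?m. \<not> y \<le> x" using supp by eventually_elim (use that in auto)
    then have "emeasure ?m {..x} = 0"
      by (subst (asm) AE_iff_measurable[of "{..x}"]) (auto simp: sets_m m.borel_UNIV)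
    then show ?thesis by (simp add: measure_def)
  qed
  then have F: "?F = cdf ?m"
    by (auto simp: fun_eq_iff cdf_def spectral_distribution_eq_measure)
  have "interval_measure (cdf ?m) = ?m"
  proof (rule cdf_unique'[OF _ m.finite_borel_measure_axioms])
    show "finite_borel_measure (interval_measure (cdf ?m))"
      by (rule finite_borel_measure_interval_measure[OF m.cdf_nondecreasing m.cdf_is_right_cont
            m.cdf_lim_at_bot m.cdf_lim_at_top measure_nonneg])
    show "cdf (interval_measure (cdf ?m)) = cdf ?m"
      by (rule cdf_interval_measure[OF m.cdf_nondecreasing m.cdf_is_right_cont m.cdf_lim_at_bot])
  qed
  then have "stieltjes_integral (spectral_distribution G \<mu>) h = (LINT x:{0..}|?m. h x)"
    unfolding stieltjes_integral_def F by simp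
  also have "\<dots> = (\<integral>x. h x \<partial>?m)"
    unfolding set_lebesgue_integral_def
    by (rule integral_cong_AE) (use supp in \<open>auto elim!: eventually_mono simp: sets_m\<close>)
  finally show ?thesis .
qed

end

section \<open>Comparison of even moments and Laplace transform\<close>

text \<open>The walk enters the comparison only through nonnegative odd moments and a positive
  second moment of 1 - x, both of which are facts about return probabilities.\<close>

locale spectral_comparison =
  fixes m :: "real measure"
  assumes prob: "prob_space m" and sets_m [measurable_cong]: "sets m = sets borel"
    and supp: "AE x in m. 0 \<le> x \<and> x \<le> 2"
    and odd_nonneg: "0 \<le> (\<integral>x. (1 - x) ^ (2 * n + 1) \<partial>m)"
    and second_pos: "0 < (\<integral>x. (1 - x)\<^sup>2 \<partial>m)"
begin

sublocale prob_space m by (rule prob)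

definition even_moment :: "nat \<Rightarrow> real" where
  "even_moment t = (\<integral>x. (1 - x) ^ (2 * t) \<partial>m)"

definition exp_moment :: "nat \<Rightarrow> real" where
  "exp_moment t = (\<integral>x. exp (- x * real t) \<partial>m)"

lemma integrable_power: "integrable m (\<lambda>x. (1 - x) ^ n)"
proof (rule integrable_const_bound[where B=1])
  show "AE x in m. norm ((1 - x) ^ n) \<le> 1"
    using supp
  proof eventually_elim
    case (elim x)
    then have "\<bar>1 - x\<bar> \<le> 1" by auto
    then show ?case by (simp add: power_abs power_le_one)
  qed
qed measurable

lemma integrable_exp: "integrable m (\<lambda>x. exp (- x * real t))"
proof (rule integrable_const_bound[where B=1])
  show "AE x in m. norm (exp (- x * real t)) \<le> 1"
    using supp by eventually_elim (simp add: mult_nonneg_nonneg)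
qed measurable

text \<open>
  The odd moments are return probabilities, hence nonnegative, so the mass near the bottom \<open>-1\<close> of
  the spectrum of the Markov operator is dominated by the mass near the top.
\<close>

lemma even_le_exp_moment: "even_moment t \<le> 2 * exp_moment t"
proof (cases t)
  case 0
  then show ?thesis by (simp add: even_moment_def exp_moment_def prob_space)
next
  case (Suc k)
  have "even_moment t + (\<integral>x. (1 - x) ^ (2 * k + 1) \<partial>m)
      = (\<integral>x. (1 - x) ^ (2 * t) + (1 - x) ^ (2 * k + 1) \<partial>m)"
    unfolding even_moment_def by (rule Bochner_Integration.integral_add[symmetric]) (rule integrable_power)+
  also have "\<dots> \<le> (\<integral>x. 2 * exp (- x * real t) \<partial>m)"
  proof (rule integral_mono_AE)
    show "AE x in m. (1 - x) ^ (2 * t) + (1 - x) ^ (2 * k + 1) \<le> 2 * exp (- x * real t)"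
      using supp
    proof eventually_elim
      case (elim x)
      have split: "(1 - x) ^ (2 * t) = (1 - x) ^ (2 * k + 1) * (1 - x)"
        using Suc by simp
      show ?case
      proof (cases "x \<le> 1")
        case True
        have "(1 - x) ^ (2 * k + 1) \<le> exp (- x) ^ (2 * k + 1)"
          using exp_ge_add_one_self[of "- x"] True by (intro power_mono) auto
        also have "\<dots> = exp (- x * real (2 * k + 1))"
          unfolding exp_of_nat_mult[symmetric] by (simp only: mult.commute)
        \<comment> \<open>Here \<open>2 * k + 1 \<ge> k + 1 = t\<close>.\<close>
        also have "\<dots> \<le> exp (- x * real t)"
          using elim Suc by (simp add: mult_left_mono)
        finally have le: "(1 - x) ^ (2 * k + 1) \<le> exp (- x * real t)" .
        moreover have "(1 - x) ^ (2 * t) \<le> (1 - x) ^ (2 * k + 1)"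
          unfolding split using True elim by (intro mult_left_le) auto
        ultimately show ?thesis by linarith
      next
        case False
        have "(1 - x) ^ (2 * k + 1) \<le> 0"
          using False by (simp add: mult_nonpos_nonneg zero_le_even_power)
        \<comment> \<open>The sum of the two powers factors through 2 - x, which is nonnegative on
          the support.\<close>
        then have "(1 - x) ^ (2 * k + 1) * (1 - x + 1) \<le> 0"
          using elim by (intro mult_nonpos_nonneg) auto
        also have "(0::real) \<le> 2 * exp (- x * real t)" by simp
        finally show ?thesis unfolding split by (simp add: algebra_simps)
      qed
    qed
  qed (intro Bochner_Integration.integrable_add integrable_mult_right integrable_power integrable_exp)+
  also have "\<dots> = 2 * exp_moment t" by (simp add: exp_moment_def)
  finally show ?thesis using odd_nonneg[of k] by linarith
qed

text \<open>Jensen's inequality for the k-th power of \<open>y = (1 - x)\<^sup>2\<close>, whose mean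
  is c. The tangent to \<open>y ^ k\<close> at c lies below it by Bernoulli's inequality and has
  integral \<open>c ^ k\<close>.\<close>

lemma even_moment_ge_power: "even_moment 1 ^ k \<le> even_moment k"
proof -
  define c where "c = even_moment 1"
  have c: "0 < c" using second_pos by (simp add: c_def even_moment_def)
  have "c ^ k = (\<integral>x. c ^ k * (1 + real k * ((1 - x)\<^sup>2 / c - 1)) \<partial>m)"
    using integrable_power[of 2] c by (simp add: prob_space c_def even_moment_def)
  also have "\<dots> \<le> (\<integral>x. (1 - x) ^ (2 * k) \<partial>m)"
  proof (rule integral_mono)
    fix x
    have "1 + real k * ((1 - x)\<^sup>2 / c - 1) \<le> (1 + ((1 - x)\<^sup>2 / c - 1)) ^ k"
      using c by (intro Bernoulli_inequality) simp
    then have "c ^ k * (1 + real k * ((1 - x)\<^sup>2 / c - 1)) \<le> c ^ k * ((1 - x)\<^sup>2 / c) ^ k"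
      using c by (intro mult_left_mono) auto
    also have "\<dots> = (1 - x) ^ (2 * k)"
      using c by (simp add: power_divide power_mult)
    finally show "c ^ k * (1 + real k * ((1 - x)\<^sup>2 / c - 1)) \<le> (1 - x) ^ (2 * k)" .
  qed (use integrable_power[of 2] integrable_power in auto)
  finally show ?thesis by (simp add: c_def even_moment_def)
qed

text \<open>The integral is split at x = 1/2. Allowing every n from \<open>q * k\<close> on leaves
  room for rounding when real arguments are treated.\<close>

lemma exp_le_even_moment:
  obtains q :: nat where "q > 0" "\<And>n k. q * k \<le> n \<Longrightarrow> exp_moment n \<le> 2 * even_moment k"
proof -
  define c where "c = even_moment 1"
  have c: "0 < c" using second_pos by (simp add: c_def even_moment_def)
  \<comment> \<open>The bound \<open>2 * ln (1 / c)\<close> gives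
    \<open>exp (- n / 2) \<le> c ^ k\<close> for the tail; the bound 4 gives
    \<open>exp (- n x) \<le> exp (- 2 x) ^ (2 k)\<close> near 0.\<close>
  obtain q :: nat where q: "max 4 (2 * ln (1 / c)) \<le> real q"
    using real_arch_simple by blast
  have "exp_moment n \<le> 2 * even_moment k" if n: "q * k \<le> n" for n k
  proof -
    have qk: "real q * real k \<le> real n" using n by (metis of_nat_le_iff of_nat_mult)
    have "exp (- real n / 2) \<le> c ^ k"
    proof -
      have "ln (1 / c) * real k \<le> real q / 2 * real k"
        using q by (intro mult_right_mono) auto
      then have "ln (1 / c) * real k \<le> real n / 2"
        using qk by simp
      then have "exp (- real n / 2) \<le> exp (real k * ln c)"
        using c by (simp add: ln_div mult.commute)
      also have "\<dots> = c ^ k"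
        using c by (simp add: exp_of_nat_mult)
      finally show ?thesis .
    qed
    then have tail: "exp (- real n / 2) \<le> even_moment k"
      using even_moment_ge_power[of k] by (simp add: c_def)
    have "exp_moment n \<le> (\<integral>x. (1 - x) ^ (2 * k) + exp (- real n / 2) \<partial>m)"
      unfolding exp_moment_def
    proof (rule integral_mono_AE)
      show "AE x in m. exp (- x * real n) \<le> (1 - x) ^ (2 * k) + exp (- real n / 2)"
        using supp
      proof eventually_elim
        case (elim x)
        show ?case
        proof (cases "x \<le> 1 / 2")
          case True
          have "4 * real k \<le> real n"
            using qk q mult_right_mono[of 4 "real q" "real k"] by simp
          then have "x * (4 * real k) \<le> x * real n"
            using elim by (intro mult_left_mono) auto
          then have "exp (- x * real n) \<le> exp (real (2 * k) * (- 2 * x))"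
            by (simp add: mult_ac)
          also have "\<dots> = exp (- 2 * x) ^ (2 * k)"
            by (rule exp_of_nat_mult)
          also have "\<dots> \<le> (1 - x) ^ (2 * k)"
          proof (rule power_mono)
            \<comment> \<open>Replacing \<open>exp (2 * x)\<close> by its tangent 1 + 2 x leaves 1 +
              x (1 - 2 x), which is at least 1 exactly because x lies in [0, 1/2].\<close>
            have "(1 - x) * exp (2 * x) \<ge> (1 - x) * (1 + 2 * x)"
              using True exp_ge_add_one_self[of "2 * x"] by (intro mult_left_mono) auto
            moreover have "(1 - x) * (1 + 2 * x) = 1 + x * (1 - 2 * x)"
              by (simp add: algebra_simps)
            moreover have "0 \<le> x * (1 - 2 * x)"
              using True elim by (intro mult_nonneg_nonneg) auto
            ultimately have "1 \<le> (1 - x) * exp (2 * x)" by linarith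
            then show "exp (- 2 * x) \<le> 1 - x"
              by (simp add: exp_minus field_simps)
          qed simp
          finally show ?thesis by (simp add: add_increasing2)
        next
          case False
          then have "1 / 2 * real n \<le> x * real n"
            by (intro mult_right_mono) auto
          then have "exp (- x * real n) \<le> exp (- real n / 2)" by simp
          then show ?thesis by (simp add: add_increasing)
        qed
      qed
    qed (use integrable_power integrable_exp in auto)
    also have "\<dots> = even_moment k + exp (- real n / 2)"
      using integrable_power by (simp add: even_moment_def prob_space)
    finally show ?thesis using tail by simp
  qed
  moreover have "q > 0" using q by (cases q) auto
  ultimately show ?thesis using that by blast
qed

lemma antimono_even_moment: "antimono even_moment"
proof (rule antimonoI)
  fix s t :: nat assume "s \<le> t"
  show "even_moment t \<le> even_moment s"
    unfolding even_moment_def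
  proof (rule integral_mono_AE)
    show "AE x in m. (1 - x) ^ (2 * t) \<le> (1 - x) ^ (2 * s)"
      using supp
    proof eventually_elim
      case (elim x)
      have "\<bar>1 - x\<bar> \<le> 1" using elim by auto
      then have "((1 - x)\<^sup>2) ^ t \<le> ((1 - x)\<^sup>2) ^ s"
        using \<open>s \<le> t\<close> by (intro power_decreasing) (auto simp: abs_square_le_1)
      then show ?case by (simp add: power_mult)
    qed
  qed (rule integrable_power)+
qed

lemma antimono_exp_moment: "antimono exp_moment"
proof (rule antimonoI)
  fix s t :: nat assume "s \<le> t"
  show "exp_moment t \<le> exp_moment s"
    unfolding exp_moment_def
  proof (rule integral_mono_AE)
    show "AE x in m. exp (- x * real t) \<le> exp (- x * real s)"
      using supp by eventually_elim (use \<open>s \<le> t\<close> in \<open>simp add: mult_left_mono\<close>)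
  qed (rule integrable_exp)+
qed

end

section \<open>From natural numbers to piecewise linear extensions\<close>

lemma piecewise_linear_ext_mono:
  assumes "\<And>t. a t \<le> C * b t"
  shows "piecewise_linear_ext a x \<le> C * piecewise_linear_ext b x"
proof -
  have "piecewise_linear_ext a x
      \<le> (1 - frac x) * (C * b (nat \<lfloor>x\<rfloor>)) + frac x * (C * b (nat \<lfloor>x\<rfloor> + 1))"
    unfolding piecewise_linear_ext_def
    using frac_lt_1[of x] by (intro add_mono mult_left_mono assms) auto
  then show ?thesis by (simp add: piecewise_linear_ext_def algebra_simps)
qed

text \<open>For decreasing sequences the extension lies between the values at the two neighbouring
  integers, so dilated arguments can be compared at integers.\<close>

lemma antimono_piecewise_linear_ext:
  assumes "antimono a"
  shows "piecewise_linear_ext a x \<le> a (nat \<lfloor>x\<rfloor>)" "a (nat \<lfloor>x\<rfloor> + 1) \<le> piecewise_linear_ext a x"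
proof -
  have step: "a (nat \<lfloor>x\<rfloor> + 1) \<le> a (nat \<lfloor>x\<rfloor>)"
    by (rule antimonoD[OF assms]) simp
  have "frac x * a (nat \<lfloor>x\<rfloor> + 1) \<le> frac x * a (nat \<lfloor>x\<rfloor>)"
    using step by (intro mult_left_mono) auto
  then show "piecewise_linear_ext a x \<le> a (nat \<lfloor>x\<rfloor>)"
    by (simp add: piecewise_linear_ext_def algebra_simps)
  have "(1 - frac x) * a (nat \<lfloor>x\<rfloor> + 1) \<le> (1 - frac x) * a (nat \<lfloor>x\<rfloor>)"
    using step frac_lt_1[of x] by (intro mult_left_mono) auto
  then show "a (nat \<lfloor>x\<rfloor> + 1) \<le> piecewise_linear_ext a x"
    by (simp add: piecewise_linear_ext_def algebra_simps)
qed

lemma (in spectral_comparison) asymp_equiv_moments: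
  "asymp_equiv_dilated (piecewise_linear_ext even_moment) (piecewise_linear_ext exp_moment)"
proof -
  have "asymp_le (piecewise_linear_ext even_moment) (piecewise_linear_ext exp_moment)"
    unfolding asymp_le_def
    by (rule exI[of _ 2], simp, rule exI[of _ 1], simp, rule exI[of _ 1])
      (use piecewise_linear_ext_mono[OF even_le_exp_moment] in simp)
  moreover have "asymp_le (piecewise_linear_ext exp_moment) (piecewise_linear_ext even_moment)"
  proof -
    obtain q :: nat where q: "q > 0" "\<And>n k. q * k \<le> n \<Longrightarrow> exp_moment n \<le> 2 * even_moment k"
      using exp_le_even_moment by blast
    \<comment> \<open>With this D, \<open>q * (D * x + 1)\<close> is x / 2 + q, which is at most x -
      1 as soon as \<open>x \<ge> 2 * q + 2\<close>. The 1 added to \<open>D * x\<close> pays for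
      the upper neighbour, the 1 subtracted from x for its floor.\<close>
    define D where "D = 1 / (2 * real q)"
    have D: "D > 0" using q(1) by (simp add: D_def)
    have "piecewise_linear_ext exp_moment x \<le> 2 * piecewise_linear_ext even_moment (D * x)"
      if x: "x \<ge> 2 * real q + 2" for x
    proof -
      let ?k = "nat \<lfloor>D * x\<rfloor> + 1"
      have "x \<ge> 0" using x by (simp add: order_trans[of 0 "2 * real q + 2"])
      have "real (nat \<lfloor>D * x\<rfloor>) \<le> D * x"
        using D \<open>x \<ge> 0\<close> by (simp add: of_nat_nat)
      then have "real q * real ?k \<le> real q * (D * x + 1)"
        by (intro mult_left_mono) auto
      also have "\<dots> = x / 2 + real q"
        using q(1) by (simp add: D_def field_simps)
      also have "\<dots> \<le> x - 1" using x by simp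
      also have "\<dots> < real (nat \<lfloor>x\<rfloor>)"
        using \<open>x \<ge> 0\<close> by (simp add: of_nat_nat)
      finally have "q * ?k \<le> nat \<lfloor>x\<rfloor>"
        by (metis less_imp_le of_nat_le_iff of_nat_mult)
      then have "exp_moment (nat \<lfloor>x\<rfloor>) \<le> 2 * even_moment ?k" by (rule q(2))
      then show ?thesis
        using antimono_piecewise_linear_ext(1)[OF antimono_exp_moment, of x]
          antimono_piecewise_linear_ext(2)[OF antimono_even_moment, of "D * x"] by linarith
    qed
    moreover have "2 * real q + 2 > 0" by simp
    ultimately show ?thesis
      unfolding asymp_le_def using D by (metis zero_less_numeral)
  qed
  ultimately show ?thesis by (simp add: asymp_equiv_dilated_def)
qed

theorem proposition3p1:
  fixes G :: "('a, 'b) monoid_scheme" and \<mu> :: "'a pmf"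
  assumes "finitely_generated_group G"
    and "infinite (carrier G)"
    and "amenable G"
    and "admissible G \<mu>"
  shows "asymp_equiv_dilated
    (piecewise_linear_ext (\<lambda>t. return_probability G \<mu> (2 * t)))
    (piecewise_linear_ext (\<lambda>t. stieltjes_integral (spectral_distribution G \<mu>)
       (\<lambda>s. exp (- s * real t))))"
proof -
  interpret symmetric_walk G \<mu>
  proof (intro symmetric_walk.intro symmetric_walk_axioms.intro)
    show "group G" using assms(1) by (simp add: finitely_generated_group_def)
    show "set_pmf \<mu> \<subseteq> carrier G" using assms(4) by (simp add: admissible_def)
    show "pmf \<mu> (inv\<^bsub>G\<^esub> g) = pmf \<mu> g" if "g \<in> carrier G" for g
      using assms(4) that by (simp add: admissible_def)
  qed
  note m = unit_spectral_measure
  interpret spectral_comparison unit_spectral_measure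
  proof (intro spectral_comparison.intro prob_spaceI)
    interpret finite_measure unit_spectral_measure by (rule laplace.spectral_finite[OF m])
    \<comment> \<open>The total mass is the zeroth moment, which is the return probability at time
      0.\<close>
    have "measure unit_spectral_measure (space unit_spectral_measure) = 1"
      using return_probability_eq_integral[of 0] by (simp add: return_probability_def)
    then show "emeasure unit_spectral_measure (space unit_spectral_measure) = 1"
      by (simp add: emeasure_eq_measure)
    show "sets unit_spectral_measure = sets borel" by (rule laplace.spectral_sets[OF m])
    show "AE x in unit_spectral_measure. 0 \<le> x \<and> x \<le> 2"
      using m by (simp only: spectral_measure_of_def)
    show "0 \<le> (\<integral>x. (1 - x) ^ (2 * n + 1) \<partial>unit_spectral_measure)" for n
      unfolding return_probability_eq_integral[symmetric] by (simp add: return_probability_def)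
    show "0 < (\<integral>x. (1 - x)\<^sup>2 \<partial>unit_spectral_measure)"
      unfolding return_probability_eq_integral[symmetric] by (rule return_probability_2_pos)
  qed
  have "(\<lambda>t. return_probability G \<mu> (2 * t)) = even_moment"
    by (simp add: fun_eq_iff even_moment_def return_probability_eq_integral)
  moreover have "(\<lambda>t. stieltjes_integral (spectral_distribution G \<mu>) (\<lambda>s. exp (- s * real t))) = exp_moment"
    unfolding fun_eq_iff exp_moment_def
    by (intro allI stieltjes_integral_spectral_distribution) measurable
  ultimately show ?thesis using asymp_equiv_moments by simp
qed

end
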